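(* Fix integers $1\leq n\leq m$ and a prime power $q$. A non-decreasing sequence of positive integers $d_1,\ldots,d_k$ is the sequence of generalized rank weights of an $\mathbb{F}_q$-linear subcode of $\mathbb{F}_q^{m\times n}$ if and only if $k\leq mn$, $d_k\leq n$, and any constant subsequence of $d_1,\ldots,d_k$ has length at most $m$.
   Context: For $n\leq m$, a (linear) rank-metric code is an $\mathbb{F}_q$-linear subspace $\mathcal{C}\subseteq\mathbb{F}_q^{m\times n}$. For such a subspace let $\mathrm{maxrk}(\mathcal{C})=\max\{\mathrm{rk}(C) : C\in\mathcal{C}\}$. A linear subspace $\mathcal{A}\subseteq\mathbb{F}_q^{m\times n}$ is an optimal anticode if $\dim(\mathcal{A})=m\cdot\mathrm{maxrk}(\mathcal{A})$. The weight of a code $\mathcal{C}$ is $\mathrm{wt}(\mathcal{C})=\min\{\mathrm{maxrk}(\mathcal{A}) : \mathcal{C}\subseteq\mathcal{A}\subseteq\mathbb{F}_q^{m\times n},\ \mathcal{A}\text{ an optimal anticode}\}$. For $1\leq r\leq\dim(\mathcal{C})$, the $r$-th generalized (rank) weight is $d_r(\mathcal{C})=\min\{\mathrm{wt}(\mathcal{D}) : \mathcal{D}\text{ is a linear subspace of }\mathcal{C},\ \dim(\mathcal{D})\geq r\}$. The sequence of generalized rank weights of $\mathcal{C}$ is $d_1(\mathcal{C}),\ldots,d_{\dim(\mathcal{C})}(\mathcal{C})$. All dimensions are over $\mathbb{F}_q$. *)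

theory Defs
  imports "HOL-Analysis.Cartesian_Space" "HOL-Library.Sublist"
begin

text \<open>
  Matrices with \<open>m\<close> rows and \<open>n\<close> columns over the finite field \<open>'q\<close> are elements of
  \<open>'q^'n^'m\<close>, with \<open>m = CARD('m)\<close> and \<open>n = CARD('n)\<close>. Below, \<open>mat_space.subspace\<close> and
  \<open>mat_space.dim\<close> are the subspaces and the dimension over \<open>'q\<close> for the entrywise scaling.
\<close>

definition mat_scale :: "'q::field \<Rightarrow> 'q^'n^'m \<Rightarrow> 'q^'n^'m" where
  "mat_scale c A = (\<chi> i j. c * A $ i $ j)"

global_interpretation mat_space: vector_space "mat_scale :: 'q::field \<Rightarrow> 'q^'n^'m \<Rightarrow> 'q^'n^'m"
  by unfold_locales (simp_all add: mat_scale_def vec_eq_iff algebra_simps)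

text \<open>
  Since \<open>'q\<close> is finite, all the sets below whose \<open>Max\<close> or \<open>Min\<close> is taken are finite. The set in
  \<open>rank_weight\<close> is nonempty when \<open>CARD('n) \<le> CARD('m)\<close>, because the whole space is then an
  optimal anticode.
\<close>

definition maxrk :: "('q::{field,finite}^'n^'m) set \<Rightarrow> nat" where
  "maxrk C = Max (rank ` C)"

definition optimal_anticode :: "('q::{field,finite}^'n^'m) set \<Rightarrow> bool" where
  "optimal_anticode A \<longleftrightarrow> mat_space.subspace A \<and> mat_space.dim A = CARD('m) * maxrk A"

definition rank_weight :: "('q::{field,finite}^'n^'m) set \<Rightarrow> nat" where
  "rank_weight C = Min {maxrk A | A. C \<subseteq> A \<and> optimal_anticode A}"

text \<open>Only meaningful for \<open>1 \<le> r \<le> mat_space.dim C\<close>.\<close>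

definition gen_rank_weight :: "nat \<Rightarrow> ('q::{field,finite}^'n^'m) set \<Rightarrow> nat" where
  "gen_rank_weight r C =
     Min {rank_weight D | D. mat_space.subspace D \<and> D \<subseteq> C \<and> r \<le> mat_space.dim D}"

definition gen_rank_weights :: "('q::{field,finite}^'n^'m) set \<Rightarrow> nat list" where
  "gen_rank_weights C = map (\<lambda>r. gen_rank_weight r C) [1..<mat_space.dim C + 1]"

end

theory Submission
  imports Defs "HOL-Algebra.Algebraic_Closure_Type"
begin

text \<open>
  Write \<open>q\<close>, \<open>m\<close>, \<open>n\<close> for the cardinalities of the types. Evaluating \<open>q\<close>-polynomials of bounded
  degree over the field with \<open>q ^ m\<close> elements (Gabidulin) yields a descending chain of codes
  \<open>G w\<close> of dimension \<open>m * (n - w)\<close> whose nonzero elements have rank larger than \<open>w\<close>. A space of matrices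
  of rank at most \<open>d\<close> meets \<open>G d\<close> trivially, so it has dimension at most \<open>m * d\<close>.

  Applied to smaller matrices as well, this bound shows that in an optimal anticode \<open>A\<close> of maximal
  rank \<open>d\<close> the fibers \<open>{v. outer u v \<in> A}\<close>, \<open>u \<noteq> 0\<close>, or (if \<open>m = n\<close>) the transposed fibers, all have
  dimension at least \<open>d\<close>; they must then coincide, as otherwise \<open>A\<close> would contain a matrix of
  rank \<open>d + 1\<close>. So \<open>A\<close> contains all matrices with rows (or columns) in a fixed subspace of
  dimension \<open>d\<close>, hence an optimal anticode of maximal rank \<open>d - 1\<close>, whose codimension in \<open>A\<close> is \<open>m\<close>.
  Therefore the \<open>(r + m)\<close>-th weight of a code exceeds the \<open>r\<close>-th.

  Conversely, a code with prescribed weights is a direct sum of subspaces of the spaces of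
  matrices in \<open>G (d - 1)\<close> supported on the first \<open>d\<close> columns, the \<open>d\<close>-th one having as dimension
  the multiplicity of \<open>d\<close>.
\<close>

section \<open>Finite subfields of the algebraic closure\<close>

text \<open>All nonempty fibers of an additive map are translates of its kernel. Dimension arguments
  are carried out on cardinalities throughout, and this count takes the place of
  rank-nullity.\<close>

lemma card_additive_image:
  fixes f :: "'a::ab_group_add \<Rightarrow> 'b::ab_group_add"
  assumes "finite A" and diff: "\<And>x y. x \<in> A \<Longrightarrow> y \<in> A \<Longrightarrow> x - y \<in> A"
    and f: "\<And>x y. x \<in> A \<Longrightarrow> y \<in> A \<Longrightarrow> f (x - y) = f x - f y"
  shows "card A = card (f ` A) * card {x \<in> A. f x = 0}"
proof -
  have fib: "card {x \<in> A. f x = b} = card {x \<in> A. f x = 0}" if b: "b \<in> f ` A" for b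
  proof -
    obtain a where a: "a \<in> A" "b = f a" using b by blast
    have neg: "- y \<in> A" if "y \<in> A" for y
      using diff[OF diff[OF that that] that] by simp
    have add: "x + y \<in> A" if "x \<in> A" "y \<in> A" for x y
      using diff[OF that(1) neg[OF that(2)]] by simp
    have f0: "f (x + a) = f x + f a" if "x \<in> A" for x
      using f[OF add[OF that a(1)] a(1)] by simp
    have "bij_betw (\<lambda>x. x + a) {x \<in> A. f x = 0} {x \<in> A. f x = b}"
      by (rule bij_betwI[of _ _ _ "\<lambda>x. x - a"]) (use a add diff f f0 in auto)
    then show ?thesis by (simp add: bij_betw_same_card)
  qed
  have "card A = (\<Sum>b\<in>f ` A. card {x \<in> A. f x = b})"
    using sum.image_gen[OF assms(1), of "\<lambda>_. 1::nat" f] by simp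
  also have "\<dots> = card (f ` A) * card {x \<in> A. f x = 0}"
    using fib by simp
  finally show ?thesis .
qed

text \<open>Addition on \<open>A \<times> B\<close> has the sums as its image and an antidiagonal
  copy of \<open>A \<inter> B\<close> as its kernel. This is the dimension formula for sums of
  subspaces in multiplicative form.\<close>

lemma card_sums_mult_card_Int:
  fixes A B :: "'a::ab_group_add set"
  assumes "finite A" "finite B"
    and A: "\<And>x y. x \<in> A \<Longrightarrow> y \<in> A \<Longrightarrow> x - y \<in> A"
    and B: "\<And>x y. x \<in> B \<Longrightarrow> y \<in> B \<Longrightarrow> x - y \<in> B"
  shows "card {x + y |x y. x \<in> A \<and> y \<in> B} * card (A \<inter> B) = card A * card B"
proof -
  have neg: "- x \<in> B" if "x \<in> B" for x using B[OF B[OF that that] that] by simp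
  have "card (A \<times> B) = card ((\<lambda>p. fst p + snd p) ` (A \<times> B)) * card {p \<in> A \<times> B. fst p + snd p = 0}"
    by (rule card_additive_image) (use assms in auto)
  moreover have "{p \<in> A \<times> B. fst p + snd p = 0} = (\<lambda>x. (x, - x)) ` (A \<inter> B)"
    using neg by (auto simp: add_eq_0_iff image_iff) (metis add.inverse_inverse neg)
  moreover have "(\<lambda>p. fst p + snd p) ` (A \<times> B) = {x + y |x y. x \<in> A \<and> y \<in> B}" by force
  moreover have "card ((\<lambda>x. (x, - x)) ` (A \<inter> B)) = card (A \<inter> B)"
    by (rule card_image) (simp add: inj_on_def)
  ultimately show ?thesis by (simp add: card_cartesian_product)
qed

text \<open>Adjoining a vector outside \<open>span B\<close> makes
  \<open>(c, x) \<mapsto> scale c a + x\<close> injective, so each basis vector contributes a factor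
  \<open>q\<close>. The scaling is a parameter because vectors, matrices and the algebraic closure
  all occur as spaces over \<open>'q\<close>; the last of these is infinite, hence the finiteness
  assumption on \<open>S\<close>.\<close>

lemma card_subspace:
  fixes scale :: "'q::{field,finite} \<Rightarrow> 'b::ab_group_add \<Rightarrow> 'b"
  assumes "vector_space scale" "module.subspace scale S" "finite S"
  shows "card S = CARD('q) ^ vector_space.dim scale S"
proof -
  interpret vector_space scale by fact
  have main: "card (span B) = CARD('q) ^ card B \<and> finite (span B)" if "finite B" "independent B" for B
    using that
  proof (induction B)
    case empty then show ?case by simp
  next
    case (insert a B)
    then have ind: "independent B" and a: "a \<notin> span B"
      by (auto simp: independent_insert split: if_splits)
    have fin: "finite (span B)" and card: "card (span B) = CARD('q) ^ card B"
      using insert.IH ind by auto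
    have eq: "span (insert a B) = (\<lambda>(c, x). scale c a + x) ` (UNIV \<times> span B)"
    proof (intro Set.set_eqI iffI)
      fix x assume "x \<in> span (insert a B)"
      then obtain c where "x - scale c a \<in> span B" by (auto simp: span_insert)
      then show "x \<in> (\<lambda>(c, x). scale c a + x) ` (UNIV \<times> span B)"
        by (intro image_eqI[of _ _ "(c, x - scale c a)"]) auto
    next
      fix x assume "x \<in> (\<lambda>(c, x). scale c a + x) ` (UNIV \<times> span B)"
      then obtain c b where "x = scale c a + b" "b \<in> span B" by auto
      then have "x - scale c a \<in> span B" by simp
      then show "x \<in> span (insert a B)" by (auto simp: span_insert)
    qed
    have "inj_on (\<lambda>(c, x). scale c a + x) (UNIV \<times> span B)"
    proof (rule inj_onI, clarsimp)
      fix c x c' x' assume *: "x \<in> span B" "x' \<in> span B" "scale c a + x = scale c' a + x'"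
      have "scale (c - c') a = x' - x"
        using *(3) by (simp add: scale_left_diff_distrib algebra_simps)
      then have mem: "scale (c - c') a \<in> span B" using * by (simp add: span_diff)
      have "c = c'"
      proof (rule ccontr)
        assume "c \<noteq> c'"
        then have "a = scale (inverse (c - c')) (scale (c - c') a)" by simp
        then have "a \<in> span B" using mem span_scale by metis
        then show False using a by simp
      qed
      then show "c = c' \<and> x = x'" using * by simp
    qed
    then show ?case using eq fin card insert.hyps
      by (simp add: card_image card_cartesian_product)
  qed
  obtain B where B: "B \<subseteq> S" "independent B" "S \<subseteq> span B" "card B = dim S"
    by (rule basis_exists)
  have "span B = S" using B assms(2) span_subspace by blast
  then show ?thesis using main[of B] B assms(3) finite_subset by metis
qed

section \<open>The Frobenius map on the algebraic closure\<close>

text \<open>Multiplication by a nonzero \<open>x\<close> permutes the nonzero elements. Comparing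
  their product before and after gives \<open>x ^ (q - 1) = 1\<close>.\<close>

lemma finite_field_power_card:
  fixes x :: "'q::{field,finite}"
  shows "x ^ CARD('q) = x"
proof (cases "x = 0")
  case False
  let ?S = "UNIV - {0} :: 'q set"
  have "bij_betw ((*) x) ?S ?S"
    using False by (intro bij_betwI[of _ _ _ "\<lambda>y. y / x"]) auto
  then have "(\<Prod>y\<in>?S. y) = (\<Prod>y\<in>?S. x * y)"
    by (rule prod.reindex_bij_betw[symmetric])
  also have "\<dots> = x ^ card ?S * (\<Prod>y\<in>?S. y)"
    by (simp add: prod.distrib)
  finally have eq: "(\<Prod>y\<in>?S. y) = x ^ card ?S * (\<Prod>y\<in>?S. y)" .
  have "(\<Prod>y\<in>?S. y) \<noteq> 0" by (subst prod_zero_iff) auto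
  then have "x ^ card ?S = 1" using eq mult_cancel_right1 by blast
  moreover have "CARD('q) = Suc (card ?S)"
    by (rule card_Suc_Diff1[OF finite UNIV_I, symmetric])
  ultimately show ?thesis by (metis power_Suc mult_1_right)
next
  case True
  then show ?thesis using finite_UNIV_card_ge_0[where 'a='q] by (simp add: power_0_left)
qed

lemma card_field_gt_1: "CARD('q::{field,finite}) > 1"
  by (metis UNIV_I card_eq_0_iff card_1_singletonE finite less_one linorder_neqE_nat one_neq_zero empty_iff singletonD)

text \<open>The shift by 1 permutes the finite field, so adding \<open>q\<close> ones to the sum of
  all elements leaves it unchanged.\<close>

lemma of_nat_card_alg_closure: "of_nat CARD('q) = (0::'q::{field,finite} alg_closure)"
proof -
  have "(\<Sum>x\<in>(UNIV::'q set). x) = (\<Sum>x\<in>(UNIV::'q set). x + 1)"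
    by (rule sum.reindex_bij_betw[symmetric]) (auto intro!: bij_betwI[of _ _ _ "\<lambda>x. x - 1"])
  also have "\<dots> = (\<Sum>x\<in>(UNIV::'q set). x) + of_nat CARD('q)"
    by (simp add: sum.distrib)
  finally have "of_nat CARD('q) = (0::'q)" by simp
  then show ?thesis by (metis to_ac_0 to_ac_of_nat)
qed

lemma range_to_ac_power: "x \<in> range (to_ac :: 'q::{field,finite} \<Rightarrow> _) \<Longrightarrow> x ^ CARD('q) = x"
  by (auto simp: finite_field_power_card simp flip: to_ac_power)

lemma card_range_to_ac: "card (range (to_ac :: 'q::{field,finite} \<Rightarrow> _)) = CARD('q)"
  by (simp add: card_image inj_to_ac)

text \<open>As polynomials in \<open>y\<close>, both sides are monic of degree \<open>q\<close> and
  vanish at the \<open>q\<close> elements of the base field.\<close>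

lemma alg_closure_prod_minus:
  fixes y :: "'q::{field,finite} alg_closure"
  shows "(\<Prod>b\<in>range to_ac. y - b) = y ^ CARD('q) - y"
proof -
  let ?q = "CARD('q)" and ?F = "range (to_ac :: 'q \<Rightarrow> _)"
  let ?P = "\<Prod>b\<in>?F. [:-b, 1:]" and ?Q = "monom 1 ?q - [:0, 1:] :: 'q alg_closure poly"
  have deg: "degree ?P = ?q"
    by (subst degree_prod_eq_sum_degree) (auto simp: card_range_to_ac)
  have lc: "lead_coeff ?P = 1"
    by (subst lead_coeff_prod) simp
  have "?P = ?Q"
  proof (rule poly_eqI_degree_lead_coeff[where n = ?q and A = ?F])
    show "coeff ?P ?q = coeff ?Q ?q"
      using deg lc card_field_gt_1[where 'q='q] by (simp add: coeff_pCons split: nat.splits)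
    show "degree ?Q \<le> ?q"
      using card_field_gt_1[where 'q='q] by (intro degree_diff_le) (auto simp: degree_monom_eq)
    show "poly ?P x = poly ?Q x" if "x \<in> ?F" for x
    proof -
      have "poly ?P x = 0" using that by (auto simp: poly_prod prod_zero_iff)
      then show ?thesis using range_to_ac_power[OF that] by (simp add: poly_monom)
    qed
  qed (use deg in \<open>auto simp: card_range_to_ac\<close>)
  then have "poly ?P y = poly ?Q y" by simp
  then show ?thesis by (simp add: poly_prod poly_monom)
qed

text \<open>The characteristic prime never enters. The product over the base field is invariant
  under shifts by its elements, which gives additivity when one summand lies in the base field. Then
  \<open>(X + y) ^ q\<close> and \<open>X ^ q + y ^ q\<close> are monic of degree \<open>q\<close>
  and agree at \<open>q\<close> points, so they are equal.\<close>

lemma frobenius_add: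
  fixes x y :: "'q::{field,finite} alg_closure"
  shows "(x + y) ^ CARD('q) = x ^ CARD('q) + y ^ CARD('q)"
proof -
  let ?q = "CARD('q)" and ?F = "range (to_ac :: 'q \<Rightarrow> _)"
  have shift: "(a + y) ^ ?q = a + y ^ ?q" if "a \<in> ?F" for a
  proof -
    have "(a + y) ^ ?q - (a + y) = (\<Prod>b\<in>?F. (a + y) - b)"
      by (simp add: alg_closure_prod_minus)
    also have "\<dots> = (\<Prod>b\<in>?F. y - b)"
    proof (rule prod.reindex_bij_witness[of _ "\<lambda>b. b + a" "\<lambda>b. b - a"])
      show "b - a \<in> ?F" "b + a \<in> ?F" if "b \<in> ?F" for b
        using that \<open>a \<in> ?F\<close> by (auto simp flip: to_ac_diff to_ac_add)
    qed (auto simp: algebra_simps)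
    also have "\<dots> = y ^ ?q - y" by (simp add: alg_closure_prod_minus)
    finally show ?thesis by (simp add: algebra_simps)
  qed
  let ?P = "[:y, 1:] ^ ?q" and ?Q = "monom 1 ?q + [:y ^ ?q:]"
  have "?P = ?Q"
  proof (rule poly_eqI_degree_lead_coeff[where n = ?q and A = ?F])
    show "coeff ?P ?q = coeff ?Q ?q"
      using lead_coeff_power[of "[:y, 1:]" ?q] card_field_gt_1[where 'q='q]
      by (simp add: degree_linear_power coeff_pCons split: nat.splits)
    show "degree ?Q \<le> ?q" by (intro degree_add_le) (auto simp: degree_monom_eq)
    show "poly ?P a = poly ?Q a" if "a \<in> ?F" for a
      using shift[OF that] range_to_ac_power[OF that] by (simp add: poly_monom add.commute)
  qed (auto simp: card_range_to_ac degree_linear_power)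
  then have "poly ?P x = poly ?Q x" by simp
  then show ?thesis by (simp add: poly_monom add.commute)
qed

lemma frobenius_iter_add:
  fixes x y :: "'q::{field,finite} alg_closure"
  shows "(x + y) ^ (CARD('q) ^ l) = x ^ (CARD('q) ^ l) + y ^ (CARD('q) ^ l)"
proof (induction l)
  case (Suc l)
  have *: "z ^ (CARD('q) ^ Suc l) = (z ^ (CARD('q) ^ l)) ^ CARD('q)" for z :: "'q alg_closure"
    by (simp add: power_mult mult.commute flip: power_mult)
  show ?case unfolding * Suc.IH by (rule frobenius_add)
qed simp

lemma frobenius_iter_sum:
  fixes f :: "'b \<Rightarrow> 'q::{field,finite} alg_closure"
  shows "(\<Sum>i\<in>S. f i) ^ (CARD('q) ^ l) = (\<Sum>i\<in>S. f i ^ (CARD('q) ^ l))"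
  by (induction S rule: infinite_finite_induct)
    (simp_all add: frobenius_iter_add power_0_left)

lemma frobenius_iter_to_ac: "to_ac a ^ (CARD('q) ^ l) = to_ac (a :: 'q::{field,finite})"
proof (induction l)
  case (Suc l)
  have "to_ac a ^ (CARD('q) ^ Suc l) = (to_ac a ^ (CARD('q) ^ l)) ^ CARD('q)"
    by (simp add: mult.commute flip: power_mult)
  then show ?case using Suc by (simp add: range_to_ac_power)
qed simp

section \<open>Extension fields as fixed points of Frobenius powers\<close>

text \<open>For \<open>k > 0\<close> this is the field with \<open>q ^ k\<close> elements. Keeping
  it as a subset of the closure avoids a type that depends on \<open>k\<close>.\<close>

definition ac_subfield :: "nat \<Rightarrow> 'q::{field,finite} alg_closure set" where
  "ac_subfield k = {x. x ^ (CARD('q) ^ k) = x}"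

text \<open>The polynomial \<open>X ^ (q ^ k) - X\<close> splits over the closure. Since
  \<open>q = 0\<close> there, its derivative is -1, so a double root is impossible and there are
  exactly \<open>q ^ k\<close> roots.\<close>

lemma card_ac_subfield:
  assumes "k > 0"
  shows "card (ac_subfield k :: 'q::{field,finite} alg_closure set) = CARD('q) ^ k"
proof -
  let ?N = "CARD('q) ^ k"
  let ?p = "monom 1 ?N - [:0, 1:] :: 'q alg_closure poly"
  have N: "?N > 1" using card_field_gt_1[where 'q='q] assms by (rule one_less_power)
  have deg: "degree ?p = ?N"
    using N degree_add_eq_left[of "- [:0, 1:]" "monom (1 :: 'q alg_closure) ?N"]
    by (simp add: degree_monom_eq diff_conv_add_uminus del: add_uminus_conv_diff)
  have "?p \<noteq> 0" using deg N by auto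
  then obtain A where A: "size A = ?N" "?p = smult (lead_coeff ?p) (\<Prod>x\<in>#A. [:-x, 1:])"
    using alg_closed_imp_factorization[of ?p] deg by metis
  have pd: "pderiv ?p = [:-1:]"
    using assms
    by (simp add: pderiv_diff pderiv_monom pderiv_pCons of_nat_card_alg_closure power_0_left one_pCons)
  have cnt: "count A a \<le> 1" for a
  proof (rule ccontr)
    assume "\<not> count A a \<le> 1"
    then have "{#a, a#} \<subseteq># A" by (auto simp: subseteq_mset_def)
    then obtain B where "A = {#a, a#} + B" by (auto simp: mset_subset_eq_exists_conv)
    define c r where "c = lead_coeff ?p" and "r = smult c (\<Prod>x\<in>#B. [:-x, 1:])"
    have "?p = smult c (\<Prod>x\<in>#{#a, a#} + B. [:-x, 1:])"
      using A(2) unfolding c_def \<open>A = {#a, a#} + B\<close> .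
    also have "\<dots> = [:-a, 1:] * ([:-a, 1:] * r)"
      by (simp only: r_def image_mset_union prod_mset.union image_mset_add_mset image_mset_empty
          prod_mset.add_mset prod_mset_empty mult_1_right mult.assoc mult_smult_right)
    finally have r: "?p = [:-a, 1:] * ([:-a, 1:] * r)" .
    have "poly (pderiv ?p) a = 0"
      unfolding r pderiv_mult by simp
    then show False unfolding pd by simp
  qed
  have "ac_subfield k = {x. poly ?p x = 0}"
    by (simp add: ac_subfield_def poly_monom)
  also have "\<dots> = set_mset A"
  proof -
    have "poly ?p x = lead_coeff ?p * (\<Prod>y\<in>#A. x - y)" for x
      by (subst A(2)) (simp add: poly_prod_mset)
    moreover have "lead_coeff ?p \<noteq> 0" using \<open>?p \<noteq> 0\<close> by (simp only: leading_coeff_neq_0 not_False_eq_True)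
    ultimately show ?thesis by (auto simp: prod_mset_zero_iff)
  qed
  finally have "ac_subfield k = set_mset A" .
  moreover have "card (set_mset A) = size A"
  proof -
    have "size A = (\<Sum>a\<in>set_mset A. count A a)" by (simp add: size_multiset_overloaded_eq)
    also have "\<dots> = (\<Sum>a\<in>set_mset A. 1)"
      by (rule sum.cong) (use cnt in \<open>auto simp: le_Suc_eq count_eq_zero_iff\<close>)
    finally show ?thesis by simp
  qed
  ultimately show ?thesis using A(1) by simp
qed

lemma ac_subfield_mult: "x \<in> ac_subfield k \<Longrightarrow> y \<in> ac_subfield k \<Longrightarrow> x * y \<in> ac_subfield k"
  by (simp add: ac_subfield_def power_mult_distrib)

lemma ac_subfield_add: "x \<in> ac_subfield k \<Longrightarrow> y \<in> ac_subfield k \<Longrightarrow> x + y \<in> ac_subfield k"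
  by (simp add: ac_subfield_def frobenius_iter_add)

lemma ac_subfield_0: "0 \<in> ac_subfield k"
  by (simp add: ac_subfield_def power_0_left)

lemma ac_subfield_sum: "(\<And>i. i \<in> S \<Longrightarrow> f i \<in> ac_subfield k) \<Longrightarrow> (\<Sum>i\<in>S. f i) \<in> ac_subfield k"
  by (induction S rule: infinite_finite_induct) (auto simp: ac_subfield_0 ac_subfield_add)

lemma ac_subfield_1: "1 \<in> ac_subfield k"
  by (simp add: ac_subfield_def)

lemma ac_subfield_power: "x \<in> ac_subfield k \<Longrightarrow> x ^ n \<in> ac_subfield k"
  by (induction n) (auto simp: ac_subfield_1 ac_subfield_mult)

lemma ac_subfield_to_ac: "to_ac a \<in> ac_subfield k"
  by (simp add: ac_subfield_def frobenius_iter_to_ac)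

section \<open>Rank and outer products\<close>

lemma card_vec_subspace:
  fixes S :: "('q::{field,finite}^'n) set"
  shows "vec.subspace S \<Longrightarrow> card S = CARD('q) ^ vec.dim S"
  by (rule card_subspace[OF vec.vector_space_axioms]) auto

lemma card_mat_subspace:
  fixes S :: "('q::{field,finite}^'n^'m) set"
  shows "mat_space.subspace S \<Longrightarrow> card S = CARD('q) ^ mat_space.dim S"
  by (rule card_subspace[OF mat_space.vector_space_axioms]) auto

lemma power_card_le_iff: "CARD('q::{field,finite}) ^ a \<le> CARD('q) ^ b \<longleftrightarrow> a \<le> b"
  using card_field_gt_1[where 'q='q] by (simp add: power_increasing_iff)

lemma power_card_eq_iff: "CARD('q::{field,finite}) ^ a = CARD('q) ^ b \<longleftrightarrow> a = b"
  using card_field_gt_1[where 'q='q] by (simp add: power_inject_exp)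

lemma dim_le_iff_card_le:
  fixes S :: "('q::{field,finite}^'n) set"
  shows "vec.subspace S \<Longrightarrow> CARD('q) ^ d \<le> card S \<longleftrightarrow> d \<le> vec.dim S"
  by (simp add: card_vec_subspace power_card_le_iff)

text \<open>Types fix the format of vectors and matrices, so smaller formats are modelled by
  prescribing a support. Deleting a row or a column amounts to removing an index from it.\<close>

definition vec_supp :: "'n set \<Rightarrow> ('q::{field,finite}^'n) set" where
  "vec_supp S = {v. \<forall>j. j \<notin> S \<longrightarrow> v $ j = 0}"

definition mat_supp :: "'m set \<Rightarrow> 'n set \<Rightarrow> ('q::{field,finite}^'n^'m) set" where
  "mat_supp R S = {M. \<forall>i j. i \<notin> R \<or> j \<notin> S \<longrightarrow> M $ i $ j = 0}"

lemma card_vec_supp: "card (vec_supp S :: ('q::{field,finite}^'n) set) = CARD('q) ^ card S"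
proof -
  have "bij_betw (\<lambda>f. \<chi> j. if j \<in> S then f j else 0) (S \<rightarrow>\<^sub>E UNIV) (vec_supp S :: ('q^'n) set)"
    by (rule bij_betwI[of _ _ _ "\<lambda>v. \<lambda>j\<in>S. v $ j"])
      (auto simp: vec_supp_def vec_eq_iff PiE_def extensional_def restrict_def)
  then have "card (vec_supp S :: ('q^'n) set) = card (S \<rightarrow>\<^sub>E (UNIV :: 'q set))"
    by (simp add: bij_betw_same_card)
  then show ?thesis by (simp add: card_PiE)
qed

lemma card_mat_supp:
  "card (mat_supp R S :: ('q::{field,finite}^'n^'m) set) = CARD('q) ^ (card R * card S)"
proof -
  have "bij_betw (\<lambda>f. \<chi> i. if i \<in> R then f i else 0) (R \<rightarrow>\<^sub>E vec_supp S)
      (mat_supp R S :: ('q^'n^'m) set)"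
    by (rule bij_betwI[of _ _ _ "\<lambda>M. \<lambda>i\<in>R. M $ i"])
      (auto simp: vec_supp_def mat_supp_def vec_eq_iff PiE_def extensional_def restrict_def Pi_def)
  then have "card (mat_supp R S :: ('q^'n^'m) set) = card (R \<rightarrow>\<^sub>E (vec_supp S :: ('q^'n) set))"
    by (simp add: bij_betw_same_card)
  then show ?thesis by (simp add: card_PiE card_vec_supp mult.commute[of "card R"] power_mult)
qed

lemma card_mat_UNIV: "card (UNIV :: ('q::{field,finite}^'n^'m) set) = CARD('q) ^ (CARD('m) * CARD('n))"
proof -
  have "mat_supp UNIV UNIV = (UNIV :: ('q^'n^'m) set)" by (simp add: mat_supp_def)
  then show ?thesis using card_mat_supp[of "UNIV :: 'm set" "UNIV :: 'n set"] by metis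
qed

lemma mat_scale_nth [simp]: "mat_scale c A $ i $ j = c * A $ i $ j"
  by (simp add: mat_scale_def)

lemma mat_scale_row: "mat_scale c A $ i = c *s A $ i"
  by (simp add: vec_eq_iff)

lemma subspace_vec_supp: "vec.subspace (vec_supp S)"
  by (auto simp: vec_supp_def intro!: vec.subspaceI)

lemma subspace_mat_supp: "mat_space.subspace (mat_supp R S)"
  by (auto simp: mat_supp_def intro!: mat_space.subspaceI)

section \<open>Outer products and transposition\<close>

definition outer :: "'q::field^'m \<Rightarrow> 'q^'n \<Rightarrow> 'q^'n^'m" where
  "outer u v = (\<chi> i j. u $ i * v $ j)"

lemma outer_nth [simp]: "outer u v $ i $ j = u $ i * v $ j"
  by (simp add: outer_def)

lemma outer_add_left: "outer (u + u') v = outer u v + outer u' v"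
  and outer_add_right: "outer u (v + v') = outer u v + outer u v'"
  and outer_scale_left: "outer (c *s u) v = mat_scale c (outer u v)"
  and outer_scale_right: "outer u (c *s v) = mat_scale c (outer u v)"
  and outer_0_left [simp]: "outer 0 v = 0"
  and outer_0_right [simp]: "outer u 0 = 0"
  by (simp_all add: vec_eq_iff algebra_simps)

lemma transpose_outer: "transpose (outer u v) = outer v u"
  by (simp add: transpose_def vec_eq_iff)

lemma transpose_plus: "transpose (A + B) = transpose A + transpose B"
  by (simp add: transpose_def vec_eq_iff)

lemma transpose_scale: "transpose (mat_scale c A) = mat_scale c (transpose A)"
  by (simp add: transpose_def vec_eq_iff)

lemma transpose_0 [simp]: "transpose 0 = (0 :: 'a::zero^'n^'m)"
  by (simp add: transpose_def vec_eq_iff)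

lemma subspace_transpose_image:
  assumes "mat_space.subspace A"
  shows "mat_space.subspace (transpose ` A)"
proof (rule mat_space.subspaceI)
  show "0 \<in> transpose ` A"
    using mat_space.subspace_0[OF assms] by (intro image_eqI[of _ _ 0]) auto
  show "x + y \<in> transpose ` A" if "x \<in> transpose ` A" "y \<in> transpose ` A" for x y
    using that mat_space.subspace_add[OF assms] by (auto simp flip: transpose_plus)
  show "mat_scale c x \<in> transpose ` A" if "x \<in> transpose ` A" for c x
    using that mat_space.subspace_scale[OF assms] by (auto simp flip: transpose_scale)
qed

lemma transpose_mem_image: "x \<in> transpose ` A \<longleftrightarrow> transpose x \<in> A"
  by (metis image_iff transpose_transpose)

lemma card_transpose_image: "card (transpose ` A) = card A"
  by (intro card_image inj_onI) (metis transpose_transpose)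

lemma transpose_image_subset: "transpose ` A \<subseteq> mat_supp S R \<longleftrightarrow> A \<subseteq> mat_supp R S"
  by (auto simp: mat_supp_def transpose_def subset_iff)

text \<open>The coefficient of \<open>u i\<close> is the pairing of \<open>v i\<close> with
  \<open>y\<close>. So the image lies in the span of the \<open>u i\<close>, and a vector dual to
  the \<open>v i\<close> singles out one of them.\<close>

lemma sum_outer_mult_vec:
  "(\<Sum>i\<in>I. outer (u i) (v i)) *v y = (\<Sum>i\<in>I. (\<Sum>j\<in>UNIV. v i $ j * y $ j) *s u i)"
proof (subst vec_eq_iff, rule allI)
  fix a
  have "((\<Sum>i\<in>I. outer (u i) (v i)) *v y) $ a = (\<Sum>j\<in>UNIV. \<Sum>i\<in>I. u i $ a * v i $ j * y $ j)"
    by (simp add: matrix_vector_mult_def sum_component sum_distrib_right)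
  also have "\<dots> = (\<Sum>i\<in>I. \<Sum>j\<in>UNIV. u i $ a * v i $ j * y $ j)"
    by (rule sum.swap)
  also have "\<dots> = (\<Sum>i\<in>I. (\<Sum>j\<in>UNIV. v i $ j * y $ j) *s u i) $ a"
    by (simp only: sum_component vector_smult_component sum_distrib_left sum_distrib_right mult_ac)
  finally show "((\<Sum>i\<in>I. outer (u i) (v i)) *v y) $ a =
    (\<Sum>i\<in>I. (\<Sum>j\<in>UNIV. v i $ j * y $ j) *s u i) $ a" .
qed

section \<open>Rank decompositions and bounds for the rank\<close>

text \<open>Expand every row in a basis of the row space. The coordinates of all rows at the basis
  vector \<open>b\<close> form the left factor \<open>x b\<close>.\<close>

lemma rank_decomposition:
  fixes M :: "'q::field^'n^'m"
  obtains B x where "finite B" "card B = rank M" "M = (\<Sum>b\<in>B. outer (x b) b)"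
proof -
  obtain B where B: "B \<subseteq> rows M" "vec.independent B" "rows M \<subseteq> vec.span B" "card B = rank M"
    using vec.basis_exists[of "rows M"] unfolding row_rank_def_gen by metis
  have fin: "finite B" using B(2) vec.finiteI_independent by blast
  have rep: "M $ i = (\<Sum>b\<in>B. vec.representation B (M $ i) b *s b)" for i
    by (rule vec.sum_representation_eq[symmetric])
      (use B fin in \<open>auto simp: rows_def row_def vec_lambda_eta\<close>)
  have "M = (\<Sum>b\<in>B. outer (\<chi> i. vec.representation B (M $ i) b) b)"
  proof (subst vec_eq_iff, rule allI)
    fix i
    have "(\<Sum>b\<in>B. outer (\<chi> i. vec.representation B (M $ i) b) b) $ i =
        (\<Sum>b\<in>B. vec.representation B (M $ i) b *s b)"
      by (simp add: vec_eq_iff sum_component)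
    then show "M $ i = (\<Sum>b\<in>B. outer (\<chi> i. vec.representation B (M $ i) b) b) $ i"
      using rep by simp
  qed
  then show ?thesis by (rule that[OF fin B(4)])
qed

lemma dim_range_le_rank:
  fixes M :: "'q::field^'n^'m"
  shows "vec.dim (range ((*v) M)) \<le> rank M"
proof -
  obtain B x where B: "finite B" "card B = rank M" "M = (\<Sum>b\<in>B. outer (x b) b)"
    by (rule rank_decomposition)
  have "range ((*v) M) \<subseteq> vec.span (x ` B)"
    unfolding B(3) sum_outer_mult_vec
    by (auto intro!: vec.span_sum vec.span_scale intro: vec.span_base)
  then have "vec.dim (range ((*v) M)) \<le> card (x ` B)"
    using B(1) by (intro vec.dim_le_card) auto
  also have "\<dots> \<le> card B" using B(1) by (rule card_image_le)
  finally show ?thesis using B(2) by simp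
qed

lemma columns_subset_range: "columns M \<subseteq> range ((*v) (M :: 'q::field^'n^'m))"
proof
  fix c assume "c \<in> columns M"
  then obtain j where "c = column j M" by (auto simp: columns_def)
  then have "c = M *v axis j 1"
    by (simp add: vec_eq_iff column_def matrix_vector_mult_def axis_def if_distrib cong: if_cong)
  then show "c \<in> range ((*v) M)" by simp
qed

text \<open>The columns lie in the image, which is spanned by the left factors of a decomposition
  into \<open>rank M\<close> outer products.\<close>

lemma rank_transpose_le: "rank (transpose M) \<le> rank (M :: 'q::field^'n^'m)"
proof -
  have "rank (transpose M) = vec.dim (columns M)"
    by (simp add: row_rank_def_gen rows_transpose)
  also have "\<dots> \<le> vec.dim (range ((*v) M))"
    by (rule vec.dim_subset[OF columns_subset_range])
  finally show ?thesis using dim_range_le_rank[of M] by simp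
qed

lemma rank_transpose_eq: "rank (transpose M) = rank (M :: 'q::field^'n^'m)"
  using rank_transpose_le[of M] rank_transpose_le[of "transpose M"] by simp

lemma rows_eq: "rows M = range (\<lambda>i. M $ i)"
  by (auto simp: rows_def row_def vec_lambda_eta)

lemma rank_le_dim:
  fixes M :: "'q::field^'n^'m"
  assumes "\<And>i. M $ i \<in> vec.span V"
  shows "rank M \<le> vec.dim V"
  unfolding row_rank_def_gen rows_eq by (rule vec.dim_mono) (use assms in auto)

lemma rank_le_card_row_support:
  fixes M :: "'q::{field,finite}^'n^'m"
  assumes "M \<in> mat_supp R S"
  shows "rank M \<le> card S"
proof -
  have "rank M \<le> vec.dim (vec_supp S :: ('q^'n) set)"
    by (rule rank_le_dim, rule vec.span_base) (use assms in \<open>auto simp: mat_supp_def vec_supp_def\<close>)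
  moreover have "vec.dim (vec_supp S :: ('q^'n) set) = card S"
  proof -
    have "CARD('q) ^ vec.dim (vec_supp S :: ('q^'n) set) = card (vec_supp S :: ('q^'n) set)"
      by (rule card_vec_subspace[OF subspace_vec_supp, symmetric])
    then have "CARD('q) ^ vec.dim (vec_supp S :: ('q^'n) set) = CARD('q) ^ card S"
      by (simp only: card_vec_supp)
    then show ?thesis by (simp only: power_card_eq_iff)
  qed
  ultimately show ?thesis by simp
qed

lemma rank_le_CARD_cols: "rank (M :: 'q::field^'n^'m) \<le> CARD('n)"
  unfolding row_rank_def_gen using vec.dim_subset_UNIV[of "rows M"] by (simp add: vec.dimension_def card_cart_basis)

text \<open>This supplies a dual vector: extend the values prescribed on the independent family
  linearly, then read off the coordinates of the resulting functional at the standard basis.\<close>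

lemma functional_representation:
  fixes v :: "'i \<Rightarrow> 'q::field^'n"
  assumes "vec.independent (v ` I)" "inj_on v I" "k \<in> I"
  shows "\<exists>y. \<forall>i\<in>I. (\<Sum>j\<in>UNIV. v i $ j * y $ j) = (if i = k then 1 else 0)"
proof -
  \<comment> \<open>The extension is vector-valued, so the value 1 is encoded by the all-one vector
    \<open>vec 1\<close>, and any single coordinate \<open>j0\<close> of \<open>g\<close> is the
    functional sought.\<close>
  obtain g :: "'q^'n \<Rightarrow> 'q^'n" where g: "Vector_Spaces.linear (*s) (*s) g"
    and gv: "\<And>x. x \<in> v ` I \<Longrightarrow> g x = (if x = v k then vec 1 else 0)"
    using vec.linear_independent_extend[OF assms(1), of "\<lambda>x. if x = v k then vec 1 else 0"] by metis
  obtain j0 :: 'n where True by simp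
  define y where "y = (\<chi> j. g (axis j 1) $ j0)"
  have lin: "g x $ j0 = (\<Sum>j\<in>UNIV. x $ j * y $ j)" for x
  proof -
    have "x = (\<Sum>j\<in>UNIV. x $ j *s axis j 1)"
      by (simp add: basis_expansion)
    then have "g x = (\<Sum>j\<in>UNIV. x $ j *s g (axis j 1))"
      using Vector_Spaces.linear.axioms(1) g
      by (metis (mono_tags, lifting) sum.cong vec.linear_scale vec.linear_sum)
    then show ?thesis by (simp add: y_def sum_component)
  qed
  have "(\<Sum>j\<in>UNIV. v i $ j * y $ j) = (if i = k then 1 else 0)" if "i \<in> I" for i
  proof -
    have "v i = v k \<longleftrightarrow> i = k" using assms that by (auto dest: inj_onD)
    then show ?thesis using lin[of "v i"] gv[of "v i"] that by (simp split: if_splits)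
  qed
  then show ?thesis by blast
qed

text \<open>The sum maps a vector dual to \<open>v k\<close> to \<open>u k\<close>. Hence its image
  contains the whole independent family \<open>u\<close>.\<close>

lemma rank_sum_outer_ge:
  fixes u :: "'i \<Rightarrow> 'q::field^'m" and v :: "'i \<Rightarrow> 'q^'n"
  assumes "finite I" "inj_on u I" "vec.independent (u ` I)" "inj_on v I" "vec.independent (v ` I)"
  shows "card I \<le> rank (\<Sum>i\<in>I. outer (u i) (v i))"
proof -
  let ?M = "\<Sum>i\<in>I. outer (u i) (v i)"
  have "u k \<in> range ((*v) ?M)" if k: "k \<in> I" for k
  proof -
    obtain y where y: "\<forall>i\<in>I. (\<Sum>j\<in>UNIV. v i $ j * y $ j) = (if i = k then 1 else 0)"
      using functional_representation[OF assms(5,4) k] by blast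
    have "?M *v y = (\<Sum>i\<in>I. (if i = k then 1 else 0) *s u i)"
      unfolding sum_outer_mult_vec using y by (intro sum.cong) auto
    also have "\<dots> = (\<Sum>i\<in>I. if i = k then u i else 0)"
      by (rule sum.cong) auto
    also have "\<dots> = u k" using k assms(1) by simp
    finally show ?thesis by (metis rangeI)
  qed
  then have "card (u ` I) \<le> vec.dim (range ((*v) ?M))"
    using assms(3) by (intro vec.independent_card_le_dim) auto
  then show ?thesis using dim_range_le_rank[of ?M] assms(2) by (simp add: card_image)
qed

lemma card_range_le_rank:
  fixes M :: "'q::{field,finite}^'n^'m"
  shows "card (range ((*v) M)) \<le> CARD('q) ^ rank M"
proof -
  have "card (range ((*v) M)) = CARD('q) ^ vec.dim (range ((*v) M))"
    by (intro card_vec_subspace vec.subspaceI)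
      (auto simp: matrix_vector_right_distrib[symmetric] vector_scalar_commute[symmetric]
        intro: range_eqI[of _ _ 0])
  then show ?thesis using dim_range_le_rank[of M] by (simp add: power_card_le_iff)
qed

lemma card_kernel_ge:
  fixes M :: "'q::{field,finite}^'n^'m"
  assumes "rank M \<le> w" "w \<le> card S"
  shows "CARD('q) ^ (card S - w) \<le> card {y \<in> vec_supp S. M *v y = 0}"
proof -
  have "CARD('q) ^ card S = card ((*v) M ` vec_supp S) * card {y \<in> vec_supp S. M *v y = 0}"
    unfolding card_vec_supp[symmetric]
    by (rule card_additive_image)
      (auto simp: vec_supp_def matrix_vector_mult_diff_distrib)
  also have "\<dots> \<le> CARD('q) ^ w * card {y \<in> vec_supp S. M *v y = 0}"
  proof (rule mult_right_mono)
    have "card ((*v) M ` vec_supp S) \<le> card (range ((*v) M))" by (intro card_mono) auto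
    also have "\<dots> \<le> CARD('q) ^ rank M" by (rule card_range_le_rank)
    also have "\<dots> \<le> CARD('q) ^ w" using assms(1) by (simp add: power_card_le_iff)
    finally show "card ((*v) M ` vec_supp S) \<le> CARD('q) ^ w" .
  qed simp
  finally have "CARD('q) ^ w * CARD('q) ^ (card S - w) \<le> CARD('q) ^ w * card {y \<in> vec_supp S. M *v y = 0}"
    using assms(2) by (simp flip: power_add)
  then show ?thesis by simp
qed

section \<open>Maximum rank distance codes and the dimension bound\<close>

text \<open>Counting shows that the subfield has dimension \<open>card R\<close> over
  \<open>'q\<close>, so a basis of it can be indexed by \<open>R\<close>. The coordinate map is onto
  because \<open>\<beta>\<close> runs through a basis, and then injective by equality of
  cardinalities.\<close>

lemma ac_subfield_coordinates:
  fixes R :: "'m::finite set"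
  assumes "R \<noteq> {}"
  obtains \<beta> :: "'m \<Rightarrow> 'q::{field,finite} alg_closure"
  where "\<And>i. i \<in> R \<Longrightarrow> \<beta> i \<in> ac_subfield (card R)"
    and "bij_betw (\<lambda>x :: 'q^'m. \<Sum>i\<in>R. to_ac (x $ i) * \<beta> i) (vec_supp R) (ac_subfield (card R))"
proof -
  let ?K = "ac_subfield (card R) :: 'q alg_closure set"
  have "card R > 0" using assms by (simp add: card_gt_0_iff)
  then have cardK: "card ?K = CARD('q) ^ card R" by (rule card_ac_subfield)
  then have finK: "finite ?K"
    using card_field_gt_1[where 'q='q] by (intro card_ge_0_finite) simp
  interpret V: vector_space "\<lambda>a (x :: 'q alg_closure). to_ac a * x"
    by unfold_locales (simp_all add: algebra_simps)
  have sub: "V.subspace ?K"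
    by (auto intro!: V.subspaceI ac_subfield_0 ac_subfield_add ac_subfield_mult ac_subfield_to_ac)
  obtain B where B: "B \<subseteq> ?K" "V.independent B" "?K \<subseteq> V.span B" "card B = V.dim ?K"
    by (rule V.basis_exists)
  have finB: "finite B" using B(1) finK finite_subset by blast
  have "card ?K = CARD('q) ^ V.dim ?K"
    by (rule card_subspace[OF V.vector_space_axioms sub finK])
  then have "card B = card R" using cardK B(4) by (simp add: power_card_eq_iff)
  then obtain \<beta> where \<beta>: "bij_betw \<beta> R B"
    using finite_same_card_bij[of R B] finB by auto
  have mem: "\<beta> i \<in> ?K" if "i \<in> R" for i using \<beta> B(1) that by (auto simp: bij_betw_def)
  let ?\<Phi> = "\<lambda>x :: 'q^'m. \<Sum>i\<in>R. to_ac (x $ i) * \<beta> i"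
  have surj: "?\<Phi> ` vec_supp R = ?K"
  proof (intro equalityI subsetI)
    fix x assume "x \<in> ?\<Phi> ` vec_supp R"
    then show "x \<in> ?K"
      by (auto intro!: ac_subfield_sum ac_subfield_mult ac_subfield_to_ac mem)
  next
    fix x assume "x \<in> ?K"
    then have "x = (\<Sum>b\<in>B. to_ac (V.representation B x b) * b)"
      using V.sum_representation_eq[OF B(2) _ finB order_refl, of x] B(3) by auto
    also have "\<dots> = (\<Sum>i\<in>R. to_ac (V.representation B x (\<beta> i)) * \<beta> i)"
      by (rule sum.reindex_bij_betw[OF \<beta>, symmetric])
    finally have "x = ?\<Phi> (\<chi> i. if i \<in> R then V.representation B x (\<beta> i) else 0)"
      by simp
    then show "x \<in> ?\<Phi> ` vec_supp R"
      by (rule image_eqI) (simp add: vec_supp_def)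
  qed
  have "inj_on ?\<Phi> (vec_supp R)"
    by (rule eq_card_imp_inj_on) (simp_all add: surj cardK card_vec_supp)
  then show ?thesis using surj mem that by (auto simp: bij_betw_def)
qed

text \<open>The exponents \<open>q ^ l\<close> are distinct, so a nonzero \<open>c l\<close>
  survives as a coefficient, and the degree is at most \<open>q ^ (N - 1)\<close>.\<close>

lemma card_linearized_roots:
  fixes c :: "nat \<Rightarrow> 'q::{field,finite} alg_closure"
  assumes "l < N" "c l \<noteq> 0"
  shows "finite {x. (\<Sum>l<N. c l * x ^ (CARD('q) ^ l)) = 0}"
    and "card {x. (\<Sum>l<N. c l * x ^ (CARD('q) ^ l)) = 0} \<le> CARD('q) ^ (N - 1)"
proof -
  define p where "p = (\<Sum>l<N. monom (c l) (CARD('q) ^ l))"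
  have "coeff p (CARD('q) ^ l) = (\<Sum>l'<N. if l' = l then c l' else 0)"
    unfolding p_def coeff_sum coeff_monom by (rule sum.cong) (auto simp: power_card_eq_iff)
  also have "\<dots> = c l" using assms(1) by simp
  finally have "p \<noteq> 0" using assms(2) by auto
  have eq: "{x. (\<Sum>l<N. c l * x ^ (CARD('q) ^ l)) = 0} = {x. poly p x = 0}"
    by (simp add: p_def poly_sum poly_monom)
  have "degree p \<le> CARD('q) ^ (N - 1)"
    unfolding p_def
  proof (rule degree_sum_le)
    fix l assume "l \<in> {..<N}"
    then have "CARD('q) ^ l \<le> CARD('q) ^ (N - 1)" by (simp add: power_card_le_iff)
    then show "degree (monom (c l) (CARD('q) ^ l)) \<le> CARD('q) ^ (N - 1)"
      using degree_monom_le order_trans by blast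
  qed simp
  then show "card {x. (\<Sum>l<N. c l * x ^ (CARD('q) ^ l)) = 0} \<le> CARD('q) ^ (N - 1)"
    unfolding eq using card_poly_roots_bound[OF \<open>p \<noteq> 0\<close>] by simp
  show "finite {x. (\<Sum>l<N. c l * x ^ (CARD('q) ^ l)) = 0}"
    unfolding eq by (rule poly_roots_finite[OF \<open>p \<noteq> 0\<close>])
qed

text \<open>Gabidulin's construction: column \<open>j\<close> of a codeword holds the coordinates of
  the value of a \<open>q\<close>-polynomial at \<open>\<alpha> j\<close>, where the
  \<open>\<alpha> j\<close> are independent over \<open>'q\<close>. A matrix of rank at most
  \<open>w\<close> kills at least \<open>q ^ (card S - w)\<close> vectors supported on
  \<open>S\<close>, and these yield distinct roots of its polynomial. A nonzero polynomial with
  \<open>card S - w\<close> coefficients has fewer roots.\<close>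

lemma max_rank_distance_codes:
  fixes R :: "'m::finite set" and S :: "'n::finite set"
  assumes RS: "card S \<le> card R"
  shows "\<exists>G :: nat \<Rightarrow> ('q::{field,finite}^'n^'m) set.
    \<forall>w. mat_space.subspace (G w) \<and> G w \<subseteq> mat_supp R S \<and> (\<forall>w'\<ge>w. G w' \<subseteq> G w) \<and>
      (w \<le> card S \<longrightarrow> card (G w) = CARD('q) ^ (card R * (card S - w)) \<and>
        (\<forall>M\<in>G w. rank M \<le> w \<longrightarrow> M = 0))"
proof (cases "R = {}")
  \<comment> \<open>Without rows the field construction breaks down, since
    \<open>ac_subfield 0\<close> is the whole closure. All codes are then zero.\<close>
  case True
  then have "card S = 0" using RS by simp
  have "mat_space.subspace {0 :: 'q^'n^'m}" by (rule mat_space.subspace_single_0)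
  then show ?thesis
    using True \<open>card S = 0\<close> by (intro exI[of _ "\<lambda>_. {0}"]) (simp add: mat_supp_def)
next
  case False
  let ?K = "ac_subfield (card R) :: 'q alg_closure set"
  obtain \<beta> :: "'m \<Rightarrow> 'q alg_closure" where \<beta>: "\<And>i. i \<in> R \<Longrightarrow> \<beta> i \<in> ?K"
    and bij: "bij_betw (\<lambda>x :: 'q^'m. \<Sum>i\<in>R. to_ac (x $ i) * \<beta> i) (vec_supp R) ?K"
    by (rule ac_subfield_coordinates[OF False, where 'q='q]) (erule that, assumption)
  define \<Phi> where "\<Phi> x = (\<Sum>i\<in>R. to_ac (x $ i) * \<beta> i)" for x :: "'q^'m"
  have \<Phi>_add: "\<Phi> (x + y) = \<Phi> x + \<Phi> y" for x y
    by (simp add: \<Phi>_def algebra_simps sum.distrib)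
  have \<Phi>_scale: "\<Phi> (a *s x) = to_ac a * \<Phi> x" for a x
    by (simp add: \<Phi>_def sum_distrib_left mult.assoc)
  have \<Phi>_0: "\<Phi> 0 = 0" by (simp add: \<Phi>_def)
  have \<Phi>_sum: "\<Phi> (\<Sum>i\<in>I. f i) = (\<Sum>i\<in>I. \<Phi> (f i))" for f :: "'n \<Rightarrow> _" and I
    by (induction I rule: infinite_finite_induct) (auto simp: \<Phi>_0 \<Phi>_add)
  have \<Phi>_inj: "x = y" if "x \<in> vec_supp R" "y \<in> vec_supp R" "\<Phi> x = \<Phi> y" for x y
    using bij that by (auto simp: bij_betw_def \<Phi>_def dest: inj_onD)
  have \<Phi>_surj: "\<exists>x\<in>vec_supp R. \<Phi> x = z" if "z \<in> ?K" for z
  proof -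
    have "z \<in> \<Phi> ` vec_supp R" using bij that unfolding bij_betw_def \<Phi>_def by simp
    then show ?thesis by blast
  qed
  \<comment> \<open>There are at least as many rows as columns, so the basis elements indexed by an
    embedded copy of \<open>S\<close> serve as evaluation points.\<close>
  obtain \<iota> where \<iota>: "\<iota> ` S \<subseteq> R" "inj_on \<iota> S"
    using card_le_inj[OF _ _ RS] by auto
  define \<alpha> where "\<alpha> j = \<beta> (\<iota> j)" for j
  define \<Psi> where "\<Psi> y = (\<Sum>j\<in>S. to_ac (y $ j) * \<alpha> j)" for y :: "'q^'n"
  have \<Psi>_inj: "inj_on \<Psi> (vec_supp S)"
  proof (rule inj_onI)
    fix y y' :: "'q^'n" assume *: "y \<in> vec_supp S" "y' \<in> vec_supp S" "\<Psi> y = \<Psi> y'"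
    \<comment> \<open>\<open>e\<close> transplants \<open>y\<close> along \<open>\<iota>\<close>
      into the coordinates in \<open>R\<close>. As \<open>\<Phi> (e y) = \<Psi> y\<close>,
      injectivity of \<open>\<Psi>\<close> is inherited from \<open>\<Phi>\<close>.\<close>
    define e where "e y = (\<chi> i. if i \<in> \<iota> ` S then y $ the_inv_into S \<iota> i else 0)" for y :: "'q^'n"
    have e: "\<Phi> (e y) = \<Psi> y" for y
    proof -
      have "\<Phi> (e y) = (\<Sum>i\<in>\<iota> ` S. to_ac (e y $ i) * \<beta> i)"
        unfolding \<Phi>_def by (rule sum.mono_neutral_right) (use \<iota> in \<open>auto simp: e_def\<close>)
      also have "\<dots> = (\<Sum>j\<in>S. to_ac (e y $ \<iota> j) * \<beta> (\<iota> j))"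
        by (rule sum.reindex[OF \<iota>(2), unfolded o_def])
      also have "\<dots> = \<Psi> y"
        unfolding \<Psi>_def \<alpha>_def by (rule sum.cong) (auto simp: e_def the_inv_into_f_f[OF \<iota>(2)])
      finally show ?thesis .
    qed
    have "e y \<in> vec_supp R" for y using \<iota>(1) by (auto simp: e_def vec_supp_def)
    then have eq: "e y = e y'" using \<Phi>_inj e *(3) by metis
    show "y = y'"
    proof (subst vec_eq_iff, rule allI)
      fix j
      show "y $ j = y' $ j"
      proof (cases "j \<in> S")
        case True
        have "e y $ \<iota> j = e y' $ \<iota> j" using eq by simp
        then show ?thesis using True by (simp add: e_def the_inv_into_f_f[OF \<iota>(2)])
      qed (use * in \<open>simp add: vec_supp_def\<close>)
    qed
  qed
  have \<alpha>K: "\<alpha> j \<in> ?K" if "j \<in> S" for j using \<beta> \<iota> that by (auto simp: \<alpha>_def)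
  \<comment> \<open>The sum has \<open>card S\<close> terms for every \<open>w\<close>; smaller
    degrees are imposed by letting the coefficients vanish from \<open>N\<close> on, in
    \<open>C N\<close>. This makes the codes \<open>G w\<close> a descending chain.\<close>
  define ev where "ev c x = (\<Sum>l<card S. c l * x ^ (CARD('q) ^ l))" for c and x :: "'q alg_closure"
  define C where "C N = {c. (\<forall>l. c l \<in> ?K) \<and> (\<forall>l\<ge>N. c l = 0)}" for N :: nat
  define rel where "rel M c \<longleftrightarrow> (\<forall>j\<in>S. \<Phi> (column j M) = ev c (\<alpha> j))"
    for M :: "'q^'n^'m" and c
  define G where "G w = {M \<in> mat_supp R S. \<exists>c\<in>C (card S - w). rel M c}" for w
  have ev_sum: "ev c (\<Psi> y) = (\<Sum>j\<in>S. to_ac (y $ j) * ev c (\<alpha> j))" for c y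
  proof -
    have "ev c (\<Psi> y) = (\<Sum>l<card S. \<Sum>j\<in>S. c l * (to_ac (y $ j) * \<alpha> j ^ (CARD('q) ^ l)))"
      unfolding ev_def \<Psi>_def frobenius_iter_sum power_mult_distrib frobenius_iter_to_ac sum_distrib_left ..
    also have "\<dots> = (\<Sum>j\<in>S. \<Sum>l<card S. c l * (to_ac (y $ j) * \<alpha> j ^ (CARD('q) ^ l)))"
      by (rule sum.swap)
    also have "\<dots> = (\<Sum>j\<in>S. to_ac (y $ j) * ev c (\<alpha> j))"
      by (simp only: ev_def sum_distrib_left mult_ac)
    finally show ?thesis .
  qed
  have rel_mult: "\<Phi> (M *v y) = ev c (\<Psi> y)" if "rel M c" "y \<in> vec_supp S" for M c y
  proof -
    have "M *v y = (\<Sum>j\<in>UNIV. y $ j *s column j M)"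
      by (rule matrix_mult_sum)
    also have "\<dots> = (\<Sum>j\<in>S. y $ j *s column j M)"
      by (rule sum.mono_neutral_right) (use that(2) in \<open>auto simp: vec_supp_def\<close>)
    finally have "\<Phi> (M *v y) = (\<Sum>j\<in>S. to_ac (y $ j) * \<Phi> (column j M))"
      by (simp only: \<Phi>_sum \<Phi>_scale)
    also have "\<dots> = (\<Sum>j\<in>S. to_ac (y $ j) * ev c (\<alpha> j))"
      using that(1) by (intro sum.cong) (auto simp: rel_def)
    finally show ?thesis by (simp only: ev_sum)
  qed
  have low_rank: "c l = 0" if w: "w \<le> card S" and c: "c \<in> C (card S - w)" and "rel M c" "rank M \<le> w"
    for w M c l
  proof (rule ccontr)
    assume nz: "c l \<noteq> 0"
    let ?N = "card S - w"
    have l: "l < ?N" using nz c unfolding C_def by (metis (mono_tags, lifting) mem_Collect_eq not_le)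
    have ev: "ev c x = (\<Sum>l<?N. c l * x ^ (CARD('q) ^ l))" for x
      unfolding ev_def by (rule sum.mono_neutral_right) (use c in \<open>auto simp: C_def\<close>)
    let ?Z = "{x. (\<Sum>l<?N. c l * x ^ (CARD('q) ^ l)) = 0}"
    let ?Y = "{y \<in> vec_supp S. M *v y = 0}"
    have "\<Psi> ` ?Y \<subseteq> ?Z"
    proof clarsimp
      fix y assume "y \<in> vec_supp S" "M *v y = 0"
      then show "(\<Sum>l<?N. c l * \<Psi> y ^ (CARD('q) ^ l)) = 0"
        using rel_mult[OF that(3), of y] \<Phi>_0 by (simp add: ev)
    qed
    moreover have "inj_on \<Psi> ?Y" using \<Psi>_inj by (rule inj_on_subset) auto
    ultimately have "card ?Y \<le> card ?Z"
      using card_linearized_roots(1)[of l ?N c] l nz by (metis (no_types, lifting) card_image card_mono)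
    also have "\<dots> \<le> CARD('q) ^ (?N - 1)" by (rule card_linearized_roots(2)[of l ?N c, OF l nz])
    finally have "CARD('q) ^ ?N \<le> CARD('q) ^ (?N - 1)"
      using card_kernel_ge[OF that(4) w] by simp
    then show False using l by (simp add: power_card_le_iff)
  qed
  have rel0: "M = 0" if "M \<in> mat_supp R S" "rel M c" "\<And>l. c l = 0" for M c
  proof -
    have "column j M = 0" if "j \<in> S" for j
      by (rule \<Phi>_inj) (use \<open>M \<in> mat_supp R S\<close> \<open>rel M c\<close> \<open>\<And>l. c l = 0\<close> that in
          \<open>auto simp: vec_supp_def mat_supp_def column_def rel_def ev_def \<Phi>_0[symmetric]\<close>,
          simp add: \<Phi>_def)
    then show ?thesis using that(1)
      by (auto simp: vec_eq_iff column_def mat_supp_def)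
  qed
  have rel_add: "rel (M + M') (\<lambda>l. c l + c' l)" if "rel M c" "rel M' c'" for M M' c c'
  proof -
    have "column j (M + M') = column j M + column j M'" for j
      by (simp add: column_def vec_eq_iff)
    then show ?thesis using that by (simp add: rel_def \<Phi>_add ev_def algebra_simps sum.distrib)
  qed
  have rel_scale: "rel (mat_scale a M) (\<lambda>l. to_ac a * c l)" if "rel M c" for M c a
  proof -
    have "column j (mat_scale a M) = a *s column j M" for j
      by (simp add: column_def vec_eq_iff)
    then show ?thesis using that by (simp add: rel_def \<Phi>_scale ev_def sum_distrib_left mult.assoc)
  qed
  have C_add: "(\<lambda>l. c l + c' l) \<in> C N" if "c \<in> C N" "c' \<in> C N" for c c' N
    using that by (simp add: C_def ac_subfield_add)
  have C_scale: "(\<lambda>l. to_ac a * c l) \<in> C N" if "c \<in> C N" for c a N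
    using that by (simp add: C_def ac_subfield_mult ac_subfield_to_ac)
  have sub: "mat_space.subspace (G w)" for w
  proof (rule mat_space.subspaceI)
    have "rel 0 (\<lambda>_. 0)" "(\<lambda>_. 0) \<in> C (card S - w)"
      by (auto simp: rel_def column_def ev_def \<Phi>_def C_def ac_subfield_0)
    then show "0 \<in> G w" unfolding G_def using mat_space.subspace_0[OF subspace_mat_supp] by blast
    show "x + y \<in> G w" if "x \<in> G w" "y \<in> G w" for x y
      using that rel_add C_add mat_space.subspace_add[OF subspace_mat_supp[of R S]]
      unfolding G_def by blast
    show "mat_scale a x \<in> G w" if "x \<in> G w" for a x
      using that rel_scale C_scale mat_space.subspace_scale[OF subspace_mat_supp[of R S]]
      unfolding G_def by blast
  qed
  have card: "card (G w) = CARD('q) ^ (card R * (card S - w))" if w: "w \<le> card S" for w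
  proof -
    let ?N = "card S - w"
    \<comment> \<open>\<open>h\<close> chooses the polynomial of a codeword. It is shown to be a
      bijection, so counting the codewords reduces to counting coefficient sequences.\<close>
    define h where "h M = (SOME c. c \<in> C ?N \<and> rel M c)" for M
    have h: "h M \<in> C ?N" "rel M (h M)" if "M \<in> G w" for M
    proof -
      have "\<exists>c. c \<in> C ?N \<and> rel M c" using that by (auto simp: G_def)
      from someI_ex[OF this] show "h M \<in> C ?N" "rel M (h M)" by (auto simp: h_def)
    qed
    have "bij_betw h (G w) (C ?N)"
      unfolding bij_betw_def
    proof (intro conjI inj_onI equalityI subsetI)
      fix M M' assume M: "M \<in> G w" "M' \<in> G w" "h M = h M'"
      show "M = M'"
      proof -
        have "rel (M + mat_scale (-1) M') (\<lambda>l. h M l + to_ac (-1) * h M' l)"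
          by (intro rel_add rel_scale h(2) M(1,2))
        moreover have "M + mat_scale (-1) M' \<in> mat_supp R S"
          using M by (auto simp: G_def mat_supp_def)
        ultimately have "M + mat_scale (-1) M' = 0" using M(3) by (intro rel0) auto
        then show ?thesis by (simp add: vec_eq_iff)
      qed
    next
      fix c assume "c \<in> h ` G w" then show "c \<in> C ?N" using h by auto
    next
      fix c assume c: "c \<in> C ?N"
      have "\<forall>j. \<exists>x\<in>vec_supp R. j \<in> S \<longrightarrow> \<Phi> x = ev c (\<alpha> j)"
      proof
        fix j show "\<exists>x\<in>vec_supp R. j \<in> S \<longrightarrow> \<Phi> x = ev c (\<alpha> j)"
        proof (cases "j \<in> S")
          case True
          then have "ev c (\<alpha> j) \<in> ?K"
            using c by (auto simp: ev_def C_def intro!: ac_subfield_sum ac_subfield_mult ac_subfield_power \<alpha>K)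
          then show ?thesis using \<Phi>_surj by blast
        next
          case False
          then show ?thesis by (auto simp: vec_supp_def intro!: exI[of _ 0])
        qed
      qed
      then obtain x where x: "\<And>j. x j \<in> vec_supp R" "\<And>j. j \<in> S \<Longrightarrow> \<Phi> (x j) = ev c (\<alpha> j)"
        by metis
      define M where "M = (\<chi> i j. if j \<in> S then x j $ i else 0)"
      have "column j M = x j" if "j \<in> S" for j
        using that by (simp add: column_def M_def vec_eq_iff)
      then have rel: "rel M c" by (simp add: rel_def x)
      moreover have "M \<in> mat_supp R S" using x(1) by (simp add: mat_supp_def vec_supp_def M_def)
      ultimately have M: "M \<in> G w" using c by (auto simp: G_def)
      \<comment> \<open>Uniqueness of the polynomial: the difference of two candidates describes the
        zero matrix, whose rank 0 is at most \<open>w\<close>, so \<open>low_rank\<close> makes it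
        vanish.\<close>
      have "rel (M + mat_scale (-1) M) (\<lambda>l. c l + to_ac (-1) * h M l)"
        using rel h M by (intro rel_add rel_scale) auto
      moreover have "M + mat_scale (-1) M = 0" by (simp add: vec_eq_iff)
      ultimately have rel': "rel 0 (\<lambda>l. c l + to_ac (-1) * h M l)" by simp
      have "c l + to_ac (-1) * h M l = 0" for l
        by (rule low_rank[OF w C_add[OF c C_scale[OF h(1)[OF M]]] rel'])
          (simp add: row_rank_def_gen rows_eq)
      then have "h M = c" by (auto simp: fun_eq_iff)
      then show "c \<in> h ` G w" using M by blast
    qed
    then have "card (G w) = card (C ?N)" by (rule bij_betw_same_card)
    also have "\<dots> = card ({..<?N} \<rightarrow>\<^sub>E ?K)"
    proof (rule bij_betw_same_card)
      show "bij_betw (\<lambda>c. restrict c {..<?N}) (C ?N) ({..<?N} \<rightarrow>\<^sub>E ?K)"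
        by (rule bij_betwI[of _ _ _ "\<lambda>f l. if l < ?N then f l else 0"])
          (auto simp: C_def fun_eq_iff ac_subfield_0 PiE_def extensional_def Pi_def not_less)
    qed
    also have "\<dots> = CARD('q) ^ (card R * ?N)"
      using False by (simp add: card_PiE card_ac_subfield card_gt_0_iff power_mult)
    finally show ?thesis .
  qed
  have mono: "G w' \<subseteq> G w" if "w \<le> w'" for w w'
  proof -
    have "C (card S - w') \<subseteq> C (card S - w)" using that by (auto simp: C_def)
    then show ?thesis by (auto simp: G_def)
  qed
  have rank: "M = 0" if wM: "w \<le> card S" "M \<in> G w" "rank M \<le> w" for w M
  proof -
    obtain c where c: "c \<in> C (card S - w)" "rel M c" "M \<in> mat_supp R S"
      using wM(2) by (auto simp: G_def)
    show ?thesis using rel0[OF c(3,2)] low_rank[OF wM(1) c(1,2) wM(3)] by blast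
  qed
  have "G w \<subseteq> mat_supp R S" for w by (auto simp: G_def)
  then show ?thesis using sub mono card rank by (intro exI[of _ G]) blast
qed

section \<open>The dimension bound for spaces of matrices of bounded rank\<close>

text \<open>\<open>A\<close> meets the code \<open>G d\<close> only in 0, so their sum is direct
  inside \<open>mat_supp R S\<close>, and dividing by the known size of \<open>G d\<close> leaves
  the bound. For \<open>d > card S\<close> the whole space is already small enough.\<close>

lemma card_le_of_rank_le:
  fixes A :: "('q::{field,finite}^'n^'m) set"
  assumes A: "mat_space.subspace A" "A \<subseteq> mat_supp R S" and rank: "\<And>M. M \<in> A \<Longrightarrow> rank M \<le> d"
  shows "card A \<le> CARD('q) ^ (max (card R) (card S) * d)"
proof -
  \<comment> \<open>Fresh index types allow this case to be applied to the transposed space when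
    columns outnumber rows.\<close>
  have tall: "card A \<le> CARD('q) ^ (card R * d)"
    if RS: "card S \<le> card R" and A: "mat_space.subspace A" "A \<subseteq> mat_supp R S"
      and rank: "\<And>M. M \<in> A \<Longrightarrow> rank M \<le> d"
    for R :: "'r::finite set" and S :: "'s::finite set" and A :: "('q^'s^'r) set"
  proof (cases "d \<le> card S")
    case True
    obtain G :: "nat \<Rightarrow> ('q^'s^'r) set" where
      "\<forall>w. mat_space.subspace (G w) \<and> G w \<subseteq> mat_supp R S \<and> (\<forall>w'\<ge>w. G w' \<subseteq> G w) \<and>
        (w \<le> card S \<longrightarrow> card (G w) = CARD('q) ^ (card R * (card S - w)) \<and>
          (\<forall>M\<in>G w. rank M \<le> w \<longrightarrow> M = 0))"
      using max_rank_distance_codes[OF RS, where 'q='q] by (elim exE)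
    then have G: "mat_space.subspace (G d)" "G d \<subseteq> mat_supp R S"
      and cardG: "card (G d) = CARD('q) ^ (card R * (card S - d))"
      and rankG: "\<And>M. M \<in> G d \<Longrightarrow> rank M \<le> d \<Longrightarrow> M = 0"
      using True by simp_all
    have "A \<inter> G d = {0}"
      using rankG rank mat_space.subspace_0[OF A(1)] mat_space.subspace_0[OF G(1)] by blast
    then have "card {x + y |x y. x \<in> A \<and> y \<in> G d} = card A * card (G d)"
      using card_sums_mult_card_Int[of A "G d"] mat_space.subspace_diff[OF A(1)]
        mat_space.subspace_diff[OF G(1)] by simp
    moreover have "{x + y |x y. x \<in> A \<and> y \<in> G d} \<subseteq> mat_supp R S"
      using A(2) G(2) by (auto intro!: mat_space.subspace_add[OF subspace_mat_supp])
    ultimately have "card A * card (G d) \<le> card (mat_supp R S :: ('q^'s^'r) set)"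
      using card_mono[OF finite, of "{x + y |x y. x \<in> A \<and> y \<in> G d}"] by simp
    then have "card A * CARD('q) ^ (card R * (card S - d)) \<le> CARD('q) ^ (card R * card S)"
      by (simp add: cardG card_mat_supp)
    also have "card R * card S = card R * d + card R * (card S - d)"
      using True by (simp flip: distrib_left)
    finally have "card A * CARD('q) ^ (card R * (card S - d)) \<le>
        CARD('q) ^ (card R * d) * CARD('q) ^ (card R * (card S - d))"
      by (simp only: power_add)
    then show ?thesis by simp
  next
    case False
    have "card A \<le> card (mat_supp R S :: ('q^'s^'r) set)" using A(2) by (intro card_mono) auto
    also have "\<dots> \<le> CARD('q) ^ (card R * d)"
      using False by (simp add: card_mat_supp power_card_le_iff)
    finally show ?thesis .
  qed
  show ?thesis
  proof (cases "card S \<le> card R")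
    case True
    then show ?thesis using tall[OF True A rank] by (simp add: max_def)
  next
    case False
    have "card (transpose ` A) \<le> CARD('q) ^ (card S * d)"
      using False A rank
      by (intro tall[of R S]) (auto simp: subspace_transpose_image transpose_image_subset rank_transpose_eq)
    then show ?thesis using False by (simp add: card_transpose_image max_def)
  qed
qed

section \<open>Fibers of rank-one matrices\<close>

text \<open>If \<open>A\<close> consists of all matrices with rows in \<open>V\<close>, then this is
  \<open>V\<close> for every \<open>u \<noteq> 0\<close>; the structure theory recovers
  \<open>V\<close> in this way. Column fibers are treated as row fibers of the transposed
  space.\<close>

definition row_fiber :: "('q::field^'n^'m) set \<Rightarrow> 'q^'m \<Rightarrow> ('q^'n) set" where
  "row_fiber A u = {v. outer u v \<in> A}"

text \<open>A multiple of row \<open>i\<close> is subtracted from each row, with multipliers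
  dictated by \<open>u\<close>. If \<open>u $ i \<noteq> 0\<close>, this clears row \<open>i\<close>
  and is a linear projection whose kernel consists of the matrices \<open>outer u v\<close>.\<close>

definition elim_row :: "'q::field^'m \<Rightarrow> 'm \<Rightarrow> 'q^'n^'m \<Rightarrow> 'q^'n^'m" where
  "elim_row u i M = M - outer (inverse (u $ i) *s u) (M $ i)"

lemma subspace_row_fiber: "mat_space.subspace A \<Longrightarrow> vec.subspace (row_fiber A u)"
  unfolding row_fiber_def
  by (rule vec.subspaceI)
    (auto simp: outer_add_right outer_scale_right mat_space.subspace_0 mat_space.subspace_add
      mat_space.subspace_scale)

lemma row_fiber_scale:
  assumes "mat_space.subspace A" "c \<noteq> 0"
  shows "row_fiber A (c *s u) = row_fiber A u"
proof (intro equalityI subsetI)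
  fix v assume "v \<in> row_fiber A (c *s u)"
  then have "mat_scale (inverse c) (mat_scale c (outer u v)) \<in> A"
    by (intro mat_space.subspace_scale[OF assms(1), of _ "inverse c"])
      (simp add: row_fiber_def outer_scale_left)
  then show "v \<in> row_fiber A u" using assms(2) by (simp add: row_fiber_def)
next
  fix v assume "v \<in> row_fiber A u"
  then show "v \<in> row_fiber A (c *s u)"
    by (auto simp: row_fiber_def outer_scale_left intro: mat_space.subspace_scale[OF assms(1)])
qed

lemma rank_le_0: "rank M \<le> 0 \<Longrightarrow> M = (0 :: 'q::field^'n^'m)"
  by (rule rank_decomposition[of M]) auto

text \<open>Greedy choice: fewer than \<open>d\<close> vectors chosen so far cannot span a space of
  dimension at least \<open>d\<close>.\<close>

lemma independent_transversal:
  fixes W :: "'i \<Rightarrow> ('q::field^'n) set"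
  assumes "finite I" "card I \<le> d" "\<And>i. i \<in> I \<Longrightarrow> d \<le> vec.dim (W i)"
  shows "\<exists>f. (\<forall>i\<in>I. f i \<in> W i) \<and> inj_on f I \<and> vec.independent (f ` I)"
  using assms
proof (induction I)
  case (insert a I)
  then obtain f where f: "\<forall>i\<in>I. f i \<in> W i" "inj_on f I" "vec.independent (f ` I)" by auto
  have "\<not> W a \<subseteq> vec.span (f ` I)"
  proof
    assume "W a \<subseteq> vec.span (f ` I)"
    then have "vec.dim (W a) \<le> card (f ` I)" using insert.hyps by (intro vec.dim_le_card) auto
    also have "\<dots> = card I" using f(2) by (rule card_image)
    finally show False using insert.prems insert.hyps by fastforce
  qed
  then obtain x where x: "x \<in> W a" "x \<notin> vec.span (f ` I)" by blast
  have img: "(f(a := x)) ` I = f ` I" using insert.hyps by auto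
  have "x \<notin> f ` I" using x(2) vec.span_base by blast
  then have "inj_on (f(a := x)) (insert a I)"
    using f(2) insert.hyps img by (simp add: inj_on_fun_updI)
  moreover have "vec.independent ((f(a := x)) ` insert a I)"
  proof -
    have "(f(a := x)) ` insert a I = insert x (f ` I)" using img by (metis fun_upd_same image_insert)
    then show ?thesis using f(3) x(2) by (simp add: vec.independent_insertI)
  qed
  moreover have "\<forall>i\<in>insert a I. (f(a := x)) i \<in> W i" using f(1) x(1) by auto
  ultimately show ?case by blast
qed (auto simp: vec.independent_empty)

text \<open>If no such pair exists, every \<open>x \<in> V\<close> outside \<open>span S\<close>
  confines \<open>W\<close> to \<open>span (insert x S)\<close>, and by dimension \<open>W\<close>
  equals it. So all these \<open>x\<close> lie in \<open>W\<close>, and then \<open>V\<close> is the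
  same span, contradicting \<open>V \<noteq> W\<close>.\<close>

lemma pair_outside_span:
  fixes V W :: "('q::field^'n) set"
  assumes V: "vec.subspace V" and W: "vec.subspace W" and "V \<noteq> W"
    and S: "finite S" "card S < d" and dim: "d \<le> vec.dim V" "d \<le> vec.dim W"
  shows "\<exists>x\<in>V. \<exists>y\<in>W. x \<notin> vec.span S \<and> y \<notin> vec.span (insert x S)"
proof (rule ccontr)
  assume no: "\<not> ?thesis"
  have small: "Z = vec.span (insert z S)"
    if Z: "vec.subspace Z" "d \<le> vec.dim Z" "Z \<subseteq> vec.span (insert z S)" for Z z
  proof (rule vec.subspace_dim_equal[OF Z(1) vec.subspace_span Z(3)])
    have "vec.dim (vec.span (insert z S)) \<le> card (insert z S)"
      using S(1) by (intro vec.dim_le_card) auto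
    also have "\<dots> \<le> d" using S by (simp add: card_insert_if)
    finally show "vec.dim (vec.span (insert z S)) \<le> vec.dim Z" using Z(2) by simp
  qed
  have out: "\<exists>x\<in>Z. x \<notin> vec.span S" if "d \<le> vec.dim Z" for Z
  proof (rule ccontr)
    assume "\<not> ?thesis"
    then have "Z \<subseteq> vec.span S" by blast
    then have "vec.dim Z \<le> card S" using S(1) by (rule vec.dim_le_card)
    then show False using that S(2) by simp
  qed
  obtain x where x: "x \<in> V" "x \<notin> vec.span S" using out[OF dim(1)] by blast
  then have "W \<subseteq> vec.span (insert x S)" using no by blast
  then have Wx: "W = vec.span (insert x S)" using small[OF W dim(2)] by blast
  have "V \<subseteq> vec.span (insert x S)"
  proof
    fix z assume z: "z \<in> V"
    show "z \<in> vec.span (insert x S)"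
    proof (cases "z \<in> vec.span S")
      case True
      then show ?thesis using vec.span_mono[of S "insert x S"] by blast
    next
      case False
      then have "W \<subseteq> vec.span (insert z S)" using no z by blast
      then have "W = vec.span (insert z S)" using small[OF W dim(2)] by blast
      then have "z \<in> W" by (simp add: vec.span_base)
      then show ?thesis using Wx by simp
    qed
  qed
  then have "V = vec.span (insert x S)" using small[OF V dim(1)] by blast
  then show False using Wx \<open>V \<noteq> W\<close> by simp
qed

text \<open>Two different fibers would allow an independent transversal of length \<open>d + 1\<close>,
  whose outer products sum up to a matrix of rank \<open>d + 1\<close>.\<close>

lemma row_fibers_equal:
  fixes A :: "('q::field^'n^'m) set"
  assumes A: "mat_space.subspace A" and rank: "\<And>M. M \<in> A \<Longrightarrow> rank M \<le> d" and "d < CARD('m)"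
    and dim: "\<And>u. u \<noteq> 0 \<Longrightarrow> d \<le> vec.dim (row_fiber A u)" and "u \<noteq> 0" "u' \<noteq> 0"
  shows "row_fiber A u = row_fiber A u'"
proof (rule ccontr)
  assume neq: "row_fiber A u \<noteq> row_fiber A u'"
  \<comment> \<open>For \<open>d = 0\<close> all fibers at nonzero vectors are trivial, hence equal.
    Excluding this case makes the subtraction in \<open>d - 1\<close> below exact.\<close>
  have "d \<noteq> 0"
  proof
    assume "d = 0"
    then have "A = {0}" using rank rank_le_0 mat_space.subspace_0[OF A] by blast
    moreover have "v = 0" if w: "w \<noteq> 0" and 0: "outer w v = 0" for w :: "'q^'m" and v :: "'q^'n"
    proof -
      obtain i where "w $ i \<noteq> 0" using w by (auto simp: vec_eq_iff)
      moreover have "w $ i * v $ j = 0" for j using 0 by (metis outer_nth zero_index)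
      ultimately show ?thesis by (simp add: vec_eq_iff)
    qed
    ultimately have "row_fiber A w = {0}" if "w \<noteq> 0" for w
      using that by (auto simp: row_fiber_def)
    then show False using neq assms(5,6) by simp
  qed
  have ind: "vec.independent {u, u'}" and "u \<noteq> u'"
  proof -
    show "u \<noteq> u'" using neq by auto
    have "u' \<notin> vec.span {u}"
    proof
      assume "u' \<in> vec.span {u}"
      then obtain c where c: "u' = c *s u" by (auto simp: vec.span_singleton)
      then have "c \<noteq> 0" using \<open>u' \<noteq> 0\<close> by auto
      then show False using row_fiber_scale[OF A] c neq by metis
    qed
    then show "vec.independent {u, u'}"
      using \<open>u \<noteq> 0\<close> by (subst insert_commute, intro vec.independent_insertI) (auto simp: vec.independent_empty)
  qed
  obtain E where E: "{u, u'} \<subseteq> E" "vec.independent E" "UNIV \<subseteq> vec.span E"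
    using vec.maximal_independent_subset_extend[of "{u, u'}" UNIV] ind by auto
  have "card E = CARD('m)"
    using vec.basis_card_eq_dim[OF _ E(3,2)] by (simp add: card_cart_basis)
  moreover have "finite E" using E(2) by (rule vec.finiteI_independent)
  ultimately have "d - 1 \<le> card (E - {u, u'})"
    using \<open>u \<noteq> u'\<close> E(1) \<open>d < CARD('m)\<close> by (simp add: card_Diff_subset)
  \<comment> \<open>Together with \<open>u\<close> and \<open>u'\<close> these vectors form the
    \<open>d + 1\<close> independent left factors.\<close>
  then obtain U where U: "U \<subseteq> E - {u, u'}" "card U = d - 1" "finite U"
    using obtain_subset_with_card_n by metis
  have nz: "x \<noteq> 0" if "x \<in> E" for x using that E(2) vec.dependent_zero by blast
  obtain f where f: "\<forall>x\<in>U. f x \<in> row_fiber A x" "inj_on f U" "vec.independent (f ` U)"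
  proof -
    have "d \<le> vec.dim (row_fiber A x)" if "x \<in> U" for x using that U(1) by (intro dim nz) auto
    from independent_transversal[where W = "row_fiber A", OF U(3) _ this] show ?thesis
      using U(2) that by auto
  qed
  have cf: "card (f ` U) < d" using U \<open>d \<noteq> 0\<close> card_image_le[of U f] by simp
  \<comment> \<open>Only this choice uses that the two fibers differ: with dimension
    \<open>d\<close> alone, a greedy choice could stop after \<open>d\<close> vectors.\<close>
  obtain x y where xy: "x \<in> row_fiber A u" "y \<in> row_fiber A u'"
    "x \<notin> vec.span (f ` U)" "y \<notin> vec.span (insert x (f ` U))"
    using pair_outside_span[OF subspace_row_fiber[OF A] subspace_row_fiber[OF A] neq _ cf
        dim[OF assms(5)] dim[OF assms(6)]] U(3) by auto
  define g where "g = f(u := x, u' := y)"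
  have gU: "g ` U = f ` U" using U(1) by (auto simp: g_def)
  have gu: "g u = x" "g u' = y" using \<open>u \<noteq> u'\<close> by (auto simp: g_def)
  let ?I = "insert u' (insert u U)"
  have gI: "g ` ?I = insert y (insert x (f ` U))" by (simp add: gU gu)
  have ni: "u \<notin> U" "u' \<notin> insert u U" using U(1) \<open>u \<noteq> u'\<close> by auto
  have "y \<noteq> x" "x \<notin> f ` U" "y \<notin> f ` U"
    using xy(3,4) vec.span_base[of _ "f ` U"] vec.span_base[of _ "insert x (f ` U)"] by auto
  moreover have "inj_on g U" using f(2) U(1) by (auto simp: g_def inj_on_def)
  ultimately have "inj_on g ?I" using ni gU gu by (auto simp: image_iff)
  moreover have "vec.independent (g ` ?I)"
    unfolding gI using f(3) xy by (intro vec.independent_insertI) auto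
  moreover have "vec.independent ?I" using E U(1) by (intro vec.independent_mono[OF E(2)]) auto
  ultimately have "card ?I \<le> rank (\<Sum>i\<in>?I. outer i (g i))"
    using rank_sum_outer_ge[of ?I "\<lambda>i. i" g] U(3) by simp
  moreover have "(\<Sum>i\<in>?I. outer i (g i)) \<in> A"
  proof (rule mat_space.subspace_sum[OF A])
    fix i assume "i \<in> ?I"
    then have "g i \<in> row_fiber A i" using f(1) gu xy(1,2) U(1) by (auto simp: g_def)
    then show "outer i (g i) \<in> A" by (simp add: row_fiber_def)
  qed
  moreover have "card ?I = d + 1" using ni U \<open>d \<noteq> 0\<close> by simp
  ultimately show False using rank by fastforce
qed

section \<open>Lower bounds for fibers by elimination\<close>

lemma elim_row_diff: "elim_row u i (M - N) = elim_row u i M - elim_row u i N"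
  by (simp add: elim_row_def vec_eq_iff algebra_simps)

lemma elim_row_add: "elim_row u i (M + N) = elim_row u i M + elim_row u i N"
  by (simp add: elim_row_def vec_eq_iff algebra_simps)

lemma elim_row_scale: "elim_row u i (mat_scale c M) = mat_scale c (elim_row u i M)"
  by (simp add: elim_row_def vec_eq_iff algebra_simps)

lemma elim_row_outer: "(u :: 'q::field^'m) $ i \<noteq> 0 \<Longrightarrow> elim_row u i (outer u v) = 0"
  by (simp add: elim_row_def vec_eq_iff)

lemma elim_row_supp: "(u :: 'q::{field,finite}^'m) $ i \<noteq> 0 \<Longrightarrow> M \<in> mat_supp R S \<Longrightarrow> elim_row u i M \<in> mat_supp (- {i}) S"
  by (auto simp: elim_row_def mat_supp_def)

lemma elim_row_nth: "elim_row u i M $ a = M $ a - (inverse (u $ i) * u $ a) *s M $ i"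
  by (simp add: elim_row_def vec_eq_iff)

lemma elim_row_in_span: "elim_row u i M $ a \<in> vec.span (rows M)"
  unfolding elim_row_nth
  by (intro vec.span_diff vec.span_scale vec.span_base) (auto simp: rows_eq)

lemma rank_elim_row: "rank (elim_row u i M) \<le> rank M"
  unfolding row_rank_def_gen[of M] by (rule rank_le_dim) (rule elim_row_in_span)

lemma subspace_elim_row: "mat_space.subspace A \<Longrightarrow> mat_space.subspace (elim_row u i ` A)"
proof (rule mat_space.subspaceI)
  assume A: "mat_space.subspace A"
  show "0 \<in> elim_row u i ` A"
    using mat_space.subspace_0[OF A] by (intro image_eqI[of _ _ 0]) (auto simp: elim_row_def vec_eq_iff)
  show "x + y \<in> elim_row u i ` A" if "x \<in> elim_row u i ` A" "y \<in> elim_row u i ` A" for x y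
    using that mat_space.subspace_add[OF A] by (auto simp flip: elim_row_add)
  show "mat_scale c x \<in> elim_row u i ` A" if "x \<in> elim_row u i ` A" for c x
    using that mat_space.subspace_scale[OF A] by (auto simp flip: elim_row_scale)
qed

lemma elim_row_eq_0: "elim_row u i M = 0 \<Longrightarrow> M = outer u (inverse (u $ i) *s M $ i)"
  by (simp add: elim_row_def outer_scale_left outer_scale_right)

lemma card_elim_row:
  fixes A :: "('q::{field,finite}^'n^'m) set" and u :: "'q^'m"
  assumes A: "mat_space.subspace A" and u: "u $ i \<noteq> 0"
  shows "card A = card (elim_row u i ` A) * card (row_fiber A u)"
proof -
  have "card A = card (elim_row u i ` A) * card {M \<in> A. elim_row u i M = 0}"
    by (rule card_additive_image) (auto simp: elim_row_diff mat_space.subspace_diff[OF A])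
  moreover have "{M \<in> A. elim_row u i M = 0} = outer u ` row_fiber A u"
  proof (intro equalityI subsetI)
    fix M assume "M \<in> {M \<in> A. elim_row u i M = 0}"
    then have "M \<in> A" "M = outer u (inverse (u $ i) *s M $ i)" using elim_row_eq_0[of u i M] by auto
    then show "M \<in> outer u ` row_fiber A u"
      by (metis (mono_tags, lifting) image_eqI mem_Collect_eq row_fiber_def)
  qed (use elim_row_outer[OF u] in \<open>auto simp: row_fiber_def\<close>)
  moreover have "inj (outer u :: 'q^'n \<Rightarrow> _)"
    using u by (auto simp: inj_on_def vec_eq_iff)
  ultimately show ?thesis by (simp add: card_image inj_on_subset)
qed

text \<open>The fiber is the kernel of the elimination, so a small image forces a large
  fiber.\<close>

lemma dim_row_fiber_ge:
  fixes A :: "('q::{field,finite}^'n^'m) set" and u :: "'q^'m"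
  assumes A: "mat_space.subspace A" and u: "u $ i \<noteq> 0"
    and "card A = CARD('q) ^ (a + d)" "card (elim_row u i ` A) \<le> CARD('q) ^ a"
  shows "d \<le> vec.dim (row_fiber A u)"
proof -
  have "CARD('q) ^ (a + d) \<le> CARD('q) ^ a * card (row_fiber A u)"
    using card_elim_row[OF A u] assms(3,4) by simp
  then have "CARD('q) ^ d \<le> card (row_fiber A u)" by (simp add: power_add)
  then show ?thesis using dim_le_iff_card_le[OF subspace_row_fiber[OF A]] by blast
qed

text \<open>With strictly more rows than columns, clearing a row lowers the larger side of the
  format by one. The dimension bound for the image drops by \<open>d\<close>, and the fiber has to
  make up for it.\<close>

lemma dim_row_fiber_ge_tall:
  fixes A :: "('q::{field,finite}^'n^'m) set" and u :: "'q^'m"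
  assumes A: "mat_space.subspace A" "A \<subseteq> mat_supp R S" and RS: "card S < card R" "i \<in> R"
    and card: "card A = CARD('q) ^ (card R * d)" and rank: "\<And>M. M \<in> A \<Longrightarrow> rank M \<le> d"
    and u: "u $ i \<noteq> 0" "u \<in> vec_supp R"
  shows "d \<le> vec.dim (row_fiber A u)"
proof (rule dim_row_fiber_ge[OF A(1) u(1)])
  show "card A = CARD('q) ^ ((card R - 1) * d + d)"
    using card RS by (cases "card R") (auto simp: add.commute)
  have "card (elim_row u i ` A) \<le> CARD('q) ^ (max (card (R - {i})) (card S) * d)"
  proof (rule card_le_of_rank_le)
    show "elim_row u i ` A \<subseteq> mat_supp (R - {i}) S"
      using A(2) u by (force simp: elim_row_def mat_supp_def vec_supp_def)
  qed (use A(1) rank rank_elim_row order_trans in \<open>auto simp: subspace_elim_row, blast\<close>)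
  also have "max (card (R - {i})) (card S) = card R - 1" using RS by simp
  finally show "card (elim_row u i ` A) \<le> CARD('q) ^ ((card R - 1) * d)" .
qed

definition elim_col :: "'q::field^'n \<Rightarrow> 'n \<Rightarrow> 'q^'n^'m \<Rightarrow> 'q^'n^'m" where
  "elim_col v j M = transpose (elim_row v j (transpose M))"

lemma elim_col_nth: "elim_col v j M $ a = M $ a - (M $ a $ j * inverse (v $ j)) *s v"
  by (simp add: elim_col_def elim_row_def transpose_def vec_eq_iff)

text \<open>If the rank does not drop below \<open>d\<close> when row \<open>i\<close> is eliminated, then the row spaces of
  \<open>N\<close>, of \<open>N + outer u v\<close> and of the reduced matrix coincide, so they contain \<open>v\<close>.\<close>

lemma rank_elim_row_col:
  fixes N :: "'q::{field,finite}^'n^'m" and u :: "'q^'m" and v :: "'q^'n"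
  assumes "rank N \<le> d" "rank (N + outer u v) \<le> d" "d > 0" "u $ i \<noteq> 0" "v $ j \<noteq> 0"
  shows "rank (elim_col v j (elim_row u i N)) \<le> d - 1"
proof -
  define N0 where "N0 = elim_row u i N"
  define P where "P = elim_col v j N0"
  have eq: "elim_row u i (N + outer u v) = N0"
    by (simp add: N0_def elim_row_add elim_row_outer assms(4))
  have "rank P \<le> rank N0"
    unfolding P_def elim_col_def rank_transpose_eq
    using rank_elim_row[of v j "transpose N0"] by (simp add: rank_transpose_eq)
  moreover have "rank P \<le> d - 1" if "d \<le> rank N0"
  proof -
    have sp: "vec.span (rows N0) = vec.span (rows Z)" if "elim_row u i Z = N0" "rank Z \<le> d" for Z
    proof -
      have "vec.span (rows N0) = vec.span (vec.span (rows Z))"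
      proof (rule vec.dim_eq_span)
        show "vec.dim (vec.span (rows Z)) \<le> vec.dim (rows N0)"
          using \<open>d \<le> rank N0\<close> that(2) by (simp add: row_rank_def_gen)
        show "rows N0 \<subseteq> vec.span (rows Z)"
          using elim_row_in_span[of u i Z] that(1) by (auto simp: rows_eq)
      qed
      then show ?thesis by simp
    qed
    have row: "Z $ i \<in> vec.span (rows N0)" if "elim_row u i Z = N0" "rank Z \<le> d" for Z
      unfolding sp[OF that] by (rule vec.span_base) (simp add: rows_eq)
    have "(N + outer u v) $ i - N $ i \<in> vec.span (rows N0)"
      using assms(1,2) eq by (intro vec.span_diff row) (auto simp: N0_def)
    then have "inverse (u $ i) *s ((N + outer u v) $ i - N $ i) \<in> vec.span (rows N0)"
      by (rule vec.span_scale)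
    moreover have "inverse (u $ i) *s ((N + outer u v) $ i - N $ i) = v"
      using assms(4) by (simp add: vec_eq_iff)
    ultimately have v: "v \<in> vec.span (rows N0)" by simp
    have "P $ a \<in> vec.span (rows N0)" for a
      unfolding P_def elim_col_nth
      by (intro vec.span_diff vec.span_scale v vec.span_base) (simp add: rows_eq)
    then have sub: "insert v (rows P) \<subseteq> vec.span (rows N0)" using v by (auto simp: rows_eq)
    \<comment> \<open>Column \<open>j\<close> of \<open>P\<close> is zero while \<open>v $ j\<close>
      is not, so \<open>v\<close> adds a dimension to the row space of \<open>P\<close> inside that
      of \<open>N0\<close>.\<close>
    have "rows P \<subseteq> vec_supp (- {j})"
      using assms(5) by (auto simp: P_def elim_col_nth rows_eq vec_supp_def)
    then have "vec.span (rows P) \<subseteq> vec_supp (- {j})"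
      by (rule vec.span_minimal) (rule subspace_vec_supp)
    then have "v \<notin> vec.span (rows P)" using assms(5) by (auto simp: vec_supp_def)
    then have "vec.dim (rows P) + 1 = vec.dim (insert v (rows P))" by (simp add: vec.dim_insert)
    also have "\<dots> \<le> vec.dim (vec.span (rows N0))" by (rule vec.dim_subset[OF sub])
    also have "\<dots> = rank N0" by (simp add: row_rank_def_gen)
    also have "\<dots> \<le> d" using rank_elim_row[of u i N] assms(1) by (simp add: N0_def)
    finally show ?thesis by (simp add: row_rank_def_gen)
  qed
  ultimately show ?thesis unfolding P_def N0_def by linarith
qed

lemma card_Compl_singleton: "card (- {i :: 'a::finite}) = CARD('a) - 1"
  unfolding Compl_eq_Diff_UNIV by (rule card_Diff_singleton) simp

text \<open>A nonzero fiber is already large, even for square matrices. Clearing row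
  \<open>i\<close> along \<open>u\<close> and then column \<open>j\<close> along \<open>v\<close>
  lowers the rank bound to \<open>d - 1\<close> and the larger side to at most \<open>m - 1\<close>.
  The second elimination has a kernel of dimension at most \<open>m - 1\<close>, so \<open>B\<close>
  has dimension at most \<open>(m - 1) * d\<close>, which leaves \<open>d\<close> for the
  fiber.\<close>

lemma dim_row_fiber_ge_of_mem:
  fixes A :: "('q::{field,finite}^'n^'m) set" and u :: "'q^'m" and v :: "'q^'n"
  assumes nm: "CARD('n) \<le> CARD('m)" and A: "mat_space.subspace A"
    and card: "card A = CARD('q) ^ (CARD('m) * d)" and rank: "\<And>M. M \<in> A \<Longrightarrow> rank M \<le> d"
    and uv: "outer u v \<in> A" "u \<noteq> 0" "v \<noteq> 0" and "d > 0"
  shows "d \<le> vec.dim (row_fiber A u)"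
proof -
  obtain i where i: "u $ i \<noteq> 0" using uv(2) by (auto simp: vec_eq_iff)
  obtain j where j: "v $ j \<noteq> 0" using uv(3) by (auto simp: vec_eq_iff)
  define B where "B = elim_row u i ` A"
  define P where "P = transpose ` elim_row v j ` transpose ` B"
  have B: "mat_space.subspace B" unfolding B_def by (rule subspace_elim_row[OF A])
  have Bsupp: "B \<subseteq> mat_supp (- {i}) UNIV"
    unfolding B_def using elim_row_supp[OF i, of _ UNIV UNIV] by (auto simp: mat_supp_def)
  have Psub: "mat_space.subspace P"
    unfolding P_def by (intro subspace_transpose_image subspace_elim_row B)
  have "P \<subseteq> mat_supp (- {i}) (- {j})"
  proof -
    have "transpose ` B \<subseteq> mat_supp UNIV (- {i})" using Bsupp by (simp add: transpose_image_subset)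
    then have "elim_row v j ` transpose ` B \<subseteq> mat_supp (- {j}) (- {i})"
      using elim_row_supp[OF j, of _ UNIV "- {i}"] by auto
    then show ?thesis unfolding P_def by (simp add: transpose_image_subset)
  qed
  moreover have "rank M \<le> d - 1" if M: "M \<in> P" for M
  proof -
    obtain N where N: "N \<in> A" "M = elim_col v j (elim_row u i N)"
      using M by (auto simp: P_def B_def elim_col_def)
    show ?thesis unfolding N(2)
      using N(1) by (intro rank_elim_row_col[OF rank rank \<open>d > 0\<close> i j])
        (auto intro: mat_space.subspace_add[OF A] uv(1))
  qed
  ultimately have "card P \<le> CARD('q) ^ (max (card (- {i})) (card (- {j})) * (d - 1))"
    using Psub by (intro card_le_of_rank_le)
  moreover have "max (card (- {i})) (card (- {j})) = CARD('m) - 1"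
    using nm by (simp add: card_Compl_singleton)
  ultimately have cP: "card (elim_row v j ` transpose ` B) \<le> CARD('q) ^ ((CARD('m) - 1) * (d - 1))"
    by (simp add: P_def card_transpose_image)
  \<comment> \<open>Row \<open>i\<close> of every matrix in \<open>B\<close> vanishes, which
    restricts the left factors to a coordinate hyperplane.\<close>
  have "row_fiber (transpose ` B) v \<subseteq> vec_supp (- {i})"
  proof
    fix x assume "x \<in> row_fiber (transpose ` B) v"
    then have "outer x v \<in> B" by (simp add: row_fiber_def transpose_mem_image transpose_outer)
    then have "outer x v $ i $ j = 0" using Bsupp unfolding mat_supp_def by blast
    then show "x \<in> vec_supp (- {i})" using j by (simp add: vec_supp_def)
  qed
  then have "card (row_fiber (transpose ` B) v) \<le> card (vec_supp (- {i}) :: ('q^'m) set)"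
    by (intro card_mono) auto
  then have cF: "card (row_fiber (transpose ` B) v) \<le> CARD('q) ^ (CARD('m) - 1)"
    by (simp add: card_vec_supp card_Compl_singleton)
  have "card B = card (elim_row v j ` transpose ` B) * card (row_fiber (transpose ` B) v)"
    using card_elim_row[OF subspace_transpose_image[OF B] j] by (simp add: card_transpose_image)
  also have "\<dots> \<le> CARD('q) ^ ((CARD('m) - 1) * (d - 1)) * CARD('q) ^ (CARD('m) - 1)"
    by (rule mult_mono[OF cP cF]) auto
  also have "\<dots> = CARD('q) ^ ((CARD('m) - 1) * (d - 1) + (CARD('m) - 1))"
    by (rule power_add[symmetric])
  also have "(CARD('m) - 1) * (d - 1) + (CARD('m) - 1) = (CARD('m) - 1) * d"
    using \<open>d > 0\<close> by (metis Suc_pred' mult_Suc_right add.commute)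
  finally have "card (elim_row u i ` A) \<le> CARD('q) ^ ((CARD('m) - 1) * d)"
    unfolding B_def .
  moreover have "CARD('m) * d = (CARD('m) - 1) * d + d"
    by (metis add.commute mult_Suc Suc_pred' zero_less_card_finite)
  ultimately show ?thesis using dim_row_fiber_ge[OF A i, of "(CARD('m) - 1) * d" d] card by simp
qed

section \<open>Restricting the corrections of lifted matrices\<close>

text \<open>Otherwise the pair \<open>(u, t)\<close> would extend both independent families, and the
  matrix would have rank at least \<open>card H + 1\<close>.\<close>

lemma in_span_of_rank_sum_outer_le:
  fixes g :: "'q::field^'m \<Rightarrow> 'q^'n"
  assumes "finite H" "vec.independent H" "u \<notin> vec.span H" "inj_on g H" "vec.independent (g ` H)"
    and rank: "rank ((\<Sum>x\<in>H. outer x (g x)) + outer u t) \<le> card H"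
  shows "t \<in> vec.span (g ` H)"
proof (rule ccontr)
  assume t: "t \<notin> vec.span (g ` H)"
  have "u \<notin> H" "t \<notin> g ` H" using assms(3) t vec.span_base by blast+
  define f where "f = g(u := t)"
  have img: "f ` insert u H = insert t (g ` H)" using \<open>u \<notin> H\<close> by (auto simp: f_def)
  have "inj_on f (insert u H)"
    using assms(4) \<open>u \<notin> H\<close> \<open>t \<notin> g ` H\<close> by (auto simp: f_def inj_on_def)
  moreover have "vec.independent (insert u H)" "vec.independent (f ` insert u H)"
    unfolding img by (rule vec.independent_insertI; fact)+
  ultimately have "card (insert u H) \<le> rank (\<Sum>x\<in>insert u H. outer x (f x))"
    using rank_sum_outer_ge[of "insert u H" "\<lambda>x. x" f] assms(1) by simp
  also have "(\<Sum>x\<in>insert u H. outer x (f x)) = outer u t + (\<Sum>x\<in>H. outer x (f x))"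
    using assms(1) \<open>u \<notin> H\<close> by (simp add: f_def)
  also have "(\<Sum>x\<in>H. outer x (f x)) = (\<Sum>x\<in>H. outer x (g x))"
    using \<open>u \<notin> H\<close> by (intro sum.cong) (auto simp: f_def)
  finally show False using rank assms(1) \<open>u \<notin> H\<close> by (simp add: add.commute)
qed

text \<open>\<open>w\<close> lies in the span of every family of \<open>d\<close> independent vectors containing \<open>r\<close>.\<close>

lemma outer_correction_in_span:
  fixes A :: "('q::{field,finite}^'n^'m) set" and u :: "'q^'m" and H :: "('q^'m) set"
  assumes A: "mat_space.subspace A" and rank: "\<And>M. M \<in> A \<Longrightarrow> rank M \<le> d"
    and H: "vec.subspace H" "d \<le> vec.dim H" "u \<notin> H" and d: "d < CARD('n)"
    and lift: "\<And>M. M \<in> {\<Sum>x\<in>I. outer x (g x) |I g. I \<subseteq> H} \<Longrightarrow> \<exists>t. M + outer u t \<in> A"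
    and h: "h \<in> H" "h \<noteq> 0" and r: "r \<noteq> 0" and mem: "outer h r + outer u w \<in> A"
    and "d > 0"
  shows "w \<in> vec.span {r}"
proof (rule ccontr)
  assume w: "w \<notin> vec.span {r}"
  have spanH: "vec.span I \<subseteq> H" if "I \<subseteq> H" for I using that H(1) by (rule vec.span_minimal)
  have indr: "vec.independent {w, r}"
    using w r by (intro vec.independent_insertI) (auto simp: vec.independent_empty)
  have ind_h: "vec.independent {h}" using h(2) by simp
  show False
  proof (cases "d = 1")
    case True
    have "w \<in> vec.span ((\<lambda>_. r) ` {h})"
      by (rule in_span_of_rank_sum_outer_le[of "{h}" u])
        (use spanH[of "{h}"] h H(3) r rank[OF mem] True in auto)
    then show False using w by simp
  next
    case False
    obtain E where E: "{h} \<subseteq> E" "E \<subseteq> H" "vec.independent E" "H \<subseteq> vec.span E"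
      using vec.maximal_independent_subset_extend[of "{h}" H] ind_h h by auto
    have "finite E" using E(3) by (rule vec.finiteI_independent)
    have "card E = vec.dim H" using vec.basis_card_eq_dim[OF E(2,4,3)] .
    then have "d - 1 \<le> card (E - {h})" using H(2) E(1) \<open>finite E\<close> by simp
    then obtain I' where I': "I' \<subseteq> E - {h}" "card I' = d - 1" "finite I'"
      using obtain_subset_with_card_n by metis
    define I where "I = insert h I'"
    have "h \<notin> I'" using I'(1) by blast
    then have I: "I \<subseteq> H" "finite I" "card I = d" "vec.independent I" "h \<in> I"
      using I' E \<open>d > 0\<close> vec.independent_mono[OF E(3), of I] by (auto simp: I_def)
    have "u \<notin> vec.span I" using spanH[OF I(1)] H(3) by auto
    \<comment> \<open>A second left factor \<open>h2\<close> is needed to carry \<open>r\<close>, so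
      that the right factor at \<open>h\<close> differs from \<open>r\<close> and can be altered by
      adding \<open>r\<close>.\<close>
    have "I' \<noteq> {}" using I'(2) False \<open>d > 0\<close> by auto
    then obtain h2 where h2: "h2 \<in> I'" by blast
    then have "h2 \<in> I" "h2 \<noteq> h" using I' by (auto simp: I_def)
    obtain F where F: "{w, r} \<subseteq> F" "vec.independent F" "UNIV \<subseteq> vec.span F"
      using vec.maximal_independent_subset_extend[of "{w, r}" UNIV] indr by auto
    have "finite F" using F(2) by (rule vec.finiteI_independent)
    have "w \<noteq> r" using w by (auto simp: vec.span_base)
    have "card F = CARD('n)" using vec.basis_card_eq_dim[OF _ F(3,2)] by (simp add: card_cart_basis)
    then have "d - 1 \<le> card (F - {w, r})" using F(1) d \<open>w \<noteq> r\<close> by (simp add: card_Diff_subset)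
    then obtain T' where T': "T' \<subseteq> F - {w, r}" "card T' = d - 1" "finite T'"
      using obtain_subset_with_card_n by metis
    \<comment> \<open>\<open>T\<close> consists of \<open>r\<close> and \<open>d - 1\<close> more
      vectors of a basis containing \<open>w\<close> and \<open>r\<close>. As \<open>d < n\<close>,
      it can omit \<open>w\<close>, so \<open>w\<close> lies outside its span.\<close>
    define T where "T = insert r T'"
    have "r \<notin> T'" using T'(1) by blast
    then have T: "T \<subseteq> F - {w}" "finite T" "card T = d" "r \<in> T"
      using T' F(1) \<open>w \<noteq> r\<close> \<open>d > 0\<close> by (auto simp: T_def)
    have indT: "vec.independent T" by (rule vec.independent_mono[OF F(2)]) (use T in auto)
    have "w \<notin> vec.span (F - {w})" using F(1,2) by (auto simp: vec.dependent_def)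
    then have wT: "w \<notin> vec.span T" using vec.span_mono[OF T(1)] by blast
    obtain g' where g': "bij_betw g' (I - {h2}) (T - {r})"
      using finite_same_card_bij[of "I - {h2}" "T - {r}"] I T \<open>h2 \<in> I\<close> by auto
    define g where "g = g'(h2 := r)"
    have g: "bij_betw g I T"
    proof -
      have "bij_betw g (I - {h2}) (T - {r})"
        using g' by (rule bij_betw_cong[THEN iffD1, rotated]) (auto simp: g_def)
      then have "bij_betw g (insert h2 (I - {h2})) (insert (g h2) (T - {r}))"
        by (subst notIn_Un_bij_betw3[symmetric, simplified, of h2]) (auto simp: g_def)
      then show ?thesis using \<open>h2 \<in> I\<close> \<open>r \<in> T\<close> by (simp add: g_def insert_absorb)
    qed
    have gh2: "g h2 = r" by (simp add: g_def)
    then have ghr: "g h \<noteq> r" using g \<open>h2 \<in> I\<close> \<open>h \<in> I\<close> \<open>h2 \<noteq> h\<close> by (metis bij_betw_inv_into_left)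
    \<comment> \<open>Changing one right factor by \<open>r\<close> keeps the family independent and
      within the span of \<open>T\<close>, while the sum changes by exactly
      \<open>outer h r\<close>.\<close>
    define k where "k = g(h := g h + r)"
    have gT: "g ` I = T" and ginj: "inj_on g I" using g by (auto simp: bij_betw_def)
    have gI': "g ` (I - {h}) = T - {g h}"
      using inj_on_image_set_diff[OF ginj, of I "{h}"] gT \<open>h \<in> I\<close> by simp
    have kI': "k ` (I - {h}) = T - {g h}" using gI' by (auto simp: k_def)
    have nk: "g h + r \<notin> vec.span (T - {g h})"
    proof
      assume "g h + r \<in> vec.span (T - {g h})"
      moreover have "r \<in> vec.span (T - {g h})" using \<open>r \<in> T\<close> ghr by (intro vec.span_base) auto
      ultimately have "g h + r - r \<in> vec.span (T - {g h})" by (rule vec.span_diff)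
      moreover have "g h \<in> T" using gT \<open>h \<in> I\<close> by auto
      ultimately show False using indT by (auto simp: vec.dependent_def)
    qed
    have kI: "k ` I = insert (g h + r) (T - {g h})"
    proof -
      have "k ` I = insert (k h) (k ` (I - {h}))" using \<open>h \<in> I\<close> by auto
      then show ?thesis using kI' by (simp add: k_def)
    qed
    have indk: "vec.independent (k ` I)"
      unfolding kI by (rule vec.independent_insertI[OF nk]) (rule vec.independent_mono[OF indT], auto)
    have kinj: "inj_on k I"
    proof -
      have "card (k ` I) = Suc (card (T - {g h}))"
        unfolding kI
      proof (rule card_insert_disjoint)
        show "g h + r \<notin> T - {g h}" using nk vec.span_base[of "g h + r" "T - {g h}"] by argo
      qed (use T(2) in simp)
      also have "\<dots> = card I"
        using card_Suc_Diff1[OF T(2), of "g h"] imageI[OF \<open>h \<in> I\<close>, of g] gT T(3) I(3) by simp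
      finally show ?thesis using I(2) by (intro eq_card_imp_inj_on)
    qed
    obtain t where t: "(\<Sum>x\<in>I. outer x (g x)) + outer u t \<in> A" using lift I(1) by blast
    have "t \<in> vec.span (g ` I)"
      using rank[OF t] I gT indT ginj \<open>u \<notin> vec.span I\<close>
      by (intro in_span_of_rank_sum_outer_le[of I u]) auto
    have sum_k: "(\<Sum>x\<in>I. outer x (k x)) = (\<Sum>x\<in>I. outer x (g x)) + outer h r"
    proof -
      have "(\<Sum>x\<in>I. outer x (k x)) = outer h (k h) + (\<Sum>x\<in>I - {h}. outer x (k x))"
        using I by (intro sum.remove) auto
      also have "(\<Sum>x\<in>I - {h}. outer x (k x)) = (\<Sum>x\<in>I - {h}. outer x (g x))"
        by (rule sum.cong) (auto simp: k_def)
      also have "outer h (k h) + \<dots> = outer h r + (outer h (g h) + \<dots>)"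
        by (simp add: k_def outer_add_right algebra_simps)
      also have "outer h (g h) + (\<Sum>x\<in>I - {h}. outer x (g x)) = (\<Sum>x\<in>I. outer x (g x))"
        using I by (intro sum.remove[symmetric]) auto
      finally show ?thesis by (simp add: add.commute)
    qed
    \<comment> \<open>Both \<open>t\<close> and \<open>t + w\<close> are now corrections of sums of
      \<open>d\<close> outer products, so both lie in the span of \<open>T\<close>, and so does
      \<open>w\<close>.\<close>
    have "(\<Sum>x\<in>I. outer x (k x)) + outer u (t + w) =
        ((\<Sum>x\<in>I. outer x (g x)) + outer u t) + (outer h r + outer u w)"
      unfolding sum_k by (simp add: outer_add_right algebra_simps)
    then have "(\<Sum>x\<in>I. outer x (k x)) + outer u (t + w) \<in> A"
      using mat_space.subspace_add[OF A t mem] by simp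
    from rank[OF this] have "t + w \<in> vec.span (k ` I)"
      using I indk kinj \<open>u \<notin> vec.span I\<close>
      by (intro in_span_of_rank_sum_outer_le[of I u]) auto
    moreover have "vec.span (k ` I) \<subseteq> vec.span T"
    proof (rule vec.span_minimal)
      have "g h + r \<in> vec.span T" using gT \<open>h \<in> I\<close> \<open>r \<in> T\<close> by (intro vec.span_add vec.span_base) auto
      then show "k ` I \<subseteq> vec.span T" unfolding kI by (auto intro: vec.span_base)
    qed simp
    ultimately have "t + w - t \<in> vec.span T"
      using \<open>t \<in> vec.span (g ` I)\<close> gT by (intro vec.span_diff) auto
    then show False using wT by simp
  qed
qed

section \<open>Structure of optimal anticodes\<close>

text \<open>A row fiber of dimension below \<open>d\<close> must be zero, so clearing row
  \<open>i\<close> loses nothing. The image \<open>B\<close> has one row less, and its transpose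
  falls under the strictly rectangular case: \<open>B\<close> contains \<open>outer h r\<close> for
  all \<open>h\<close> in a space \<open>H\<close> of dimension at least \<open>d\<close>. Lifting
  back to \<open>A\<close> only replaces \<open>h\<close> by \<open>h + c *s u\<close>, so the
  column fibers of \<open>A\<close> are large and coincide.\<close>

lemma full_col_fibers:
  fixes A :: "('q::{field,finite}^'n^'m) set" and u :: "'q^'m"
  assumes nm: "CARD('n) = CARD('m)" and A: "mat_space.subspace A"
    and card: "card A = CARD('q) ^ (CARD('m) * d)" and rank: "\<And>M. M \<in> A \<Longrightarrow> rank M \<le> d"
    and d: "0 < d" "d < CARD('n)" and u: "u \<noteq> 0" "\<not> d \<le> vec.dim (row_fiber A u)"
  shows "\<exists>H. vec.subspace H \<and> d \<le> vec.dim H \<and> (\<forall>h\<in>H. \<forall>v. outer h v \<in> A)"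
proof -
  obtain i where i: "u $ i \<noteq> 0" using u(1) by (auto simp: vec_eq_iff)
  have "row_fiber A u \<subseteq> {0}"
  proof
    fix v assume "v \<in> row_fiber A u"
    then have "outer u v \<in> A" by (simp add: row_fiber_def)
    then show "v \<in> {0}"
      using dim_row_fiber_ge_of_mem[OF _ A card rank, of u v] nm u d by auto
  qed
  then have fib: "row_fiber A u = {0}"
    using vec.subspace_0[OF subspace_row_fiber[OF A, of u]] by blast
  define B where "B = elim_row u i ` A"
  have B: "mat_space.subspace B" unfolding B_def by (rule subspace_elim_row[OF A])
  define Bt where "Bt = transpose ` B"
  have Bt: "mat_space.subspace Bt" unfolding Bt_def by (rule subspace_transpose_image[OF B])
  have cB: "card Bt = CARD('q) ^ (CARD('n) * d)"
    using card_elim_row[OF A i] fib card nm by (simp add: Bt_def B_def card_transpose_image)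
  have Bsupp: "B \<subseteq> mat_supp (- {i}) UNIV"
    unfolding B_def using elim_row_supp[OF i, of _ UNIV UNIV] by (auto simp: mat_supp_def)
  have Btsupp: "Bt \<subseteq> mat_supp UNIV (- {i})"
    unfolding Bt_def using Bsupp by (simp add: transpose_image_subset)
  have Brank: "rank M \<le> d" if "M \<in> B" for M
    using that rank rank_elim_row order_trans unfolding B_def by blast
  have Btrank: "rank M \<le> d" if "M \<in> Bt" for M
    using that Brank by (auto simp: Bt_def rank_transpose_eq)
  have cS: "card (- {i}) < CARD('n)" using nm by (simp add: card_Compl_singleton)
  have Btfib: "d \<le> vec.dim (row_fiber Bt r)" if r: "r \<noteq> 0" for r
  proof -
    obtain j where "r $ j \<noteq> 0" using r by (auto simp: vec_eq_iff)
    then show ?thesis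
      using cB Btrank cS by (intro dim_row_fiber_ge_tall[OF Bt Btsupp]) (auto simp: vec_supp_def)
  qed
  \<comment> \<open>All fibers at nonzero vectors will agree, so an arbitrary unit vector serves as
    reference.\<close>
  obtain j0 :: 'n where True by simp
  define r0 :: "'q^'n" where "r0 = axis j0 1"
  have r0: "r0 \<noteq> 0" by (simp add: r0_def axis_eq_0_iff)
  define H where "H = row_fiber Bt r0"
  have H: "vec.subspace H" "d \<le> vec.dim H"
    unfolding H_def using subspace_row_fiber[OF Bt] Btfib[OF r0] by auto
  have outB: "outer h r \<in> B" if "h \<in> H" for h r
  proof (cases "r = 0")
    case False
    then have "row_fiber Bt r = H"
      unfolding H_def using r0 Btfib Btrank d by (intro row_fibers_equal[OF Bt]) auto
    then have "outer r h \<in> Bt" using that by (auto simp: row_fiber_def)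
    then show ?thesis by (simp add: Bt_def transpose_mem_image transpose_outer)
  qed (simp add: mat_space.subspace_0[OF B])
  have lift: "\<exists>t. M + outer u t \<in> A" if M: "M \<in> B" for M
  proof -
    obtain N where N: "N \<in> A" "M = elim_row u i N" using M by (auto simp: B_def)
    then have "M + outer u (inverse (u $ i) *s N $ i) = N"
      by (simp add: elim_row_def outer_scale_left outer_scale_right)
    then show ?thesis using N(1) by metis
  qed
  have Hi: "h $ i = 0" if "h \<in> H" for h
  proof -
    have "outer h r0 $ i $ j0 = 0"
      using outB[OF that, of r0] Bsupp unfolding mat_supp_def by blast
    then show ?thesis by (simp add: r0_def axis_def)
  qed
  have uH: "u \<notin> H" using Hi i by auto
  have shift: "\<exists>c. outer (h + c *s u) r \<in> A" if hr: "h \<in> H" "r \<noteq> 0" for h r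
  proof (cases "h = 0")
    case True
    then show ?thesis using mat_space.subspace_0[OF A] by (intro exI[of _ 0]) simp
  next
    case False
    obtain w where w: "outer h r + outer u w \<in> A" using lift[OF outB[OF hr(1)]] by blast
    have "w \<in> vec.span {r}"
    proof (rule outer_correction_in_span[OF A rank H uH d(2) _ that(1) False that(2) w d(1)])
      fix M assume "M \<in> {\<Sum>x\<in>I. outer x (g x) |I (g :: 'q^'m \<Rightarrow> 'q^'n). I \<subseteq> H}"
      then obtain I and g :: "'q^'m \<Rightarrow> 'q^'n" where "M = (\<Sum>x\<in>I. outer x (g x))" "I \<subseteq> H" by blast
      then have "M \<in> B" using outB by (auto intro!: mat_space.subspace_sum[OF B])
      then show "\<exists>t. M + outer u t \<in> A" by (rule lift)
    qed
    then obtain c where "w = c *s r" by (auto simp: vec.span_singleton)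
    then have "outer (h + c *s u) r = outer h r + outer u w"
      by (simp add: outer_add_left outer_scale_left outer_scale_right)
    then show ?thesis using w by metis
  qed
  define At where "At = transpose ` A"
  have At: "mat_space.subspace At" unfolding At_def by (rule subspace_transpose_image[OF A])
  have Atrank: "rank M \<le> d" if "M \<in> At" for M using that rank by (auto simp: At_def rank_transpose_eq)
  have Atfib: "d \<le> vec.dim (row_fiber At r)" if r: "r \<noteq> 0" for r
  proof -
    \<comment> \<open>The shift \<open>c h\<close> is chosen separately for each \<open>h\<close>
      and need not be linear. Injectivity is seen in coordinate \<open>i\<close>, where
      \<open>h\<close> vanishes and \<open>u\<close> does not; comparing cardinalities then
      suffices.\<close>
    obtain c where c: "\<And>h. h \<in> H \<Longrightarrow> outer (h + c h *s u) r \<in> A" using shift[OF _ r] by metis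
    have "inj_on (\<lambda>h. h + c h *s u) H"
    proof (rule inj_onI)
      fix h h' assume *: "h \<in> H" "h' \<in> H" "h + c h *s u = h' + c h' *s u"
      then have "(h + c h *s u) $ i = (h' + c h' *s u) $ i" by simp
      then have "c h = c h'" using Hi *(1,2) i by simp
      then show "h = h'" using *(3) by simp
    qed
    moreover have "(\<lambda>h. h + c h *s u) ` H \<subseteq> row_fiber At r"
      using c by (auto simp: row_fiber_def At_def transpose_mem_image transpose_outer)
    ultimately have "card H \<le> card (row_fiber At r)"
      using card_inj_on_le[of _ H "row_fiber At r"] by auto
    moreover have "CARD('q) ^ d \<le> card H" using dim_le_iff_card_le[OF H(1)] H(2) by blast
    ultimately show ?thesis
      using dim_le_iff_card_le[OF subspace_row_fiber[OF At], of d r] by linarith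
  qed
  have "outer h v \<in> A" if "h \<in> row_fiber At r0" for h v
  proof (cases "v = 0")
    case False
    then have "row_fiber At v = row_fiber At r0"
      using r0 Atfib Atrank d by (intro row_fibers_equal[OF At]) auto
    then have "outer v h \<in> At" using that by (auto simp: row_fiber_def)
    then show ?thesis by (simp add: At_def transpose_mem_image transpose_outer)
  qed (simp add: mat_space.subspace_0[OF A])
  then show ?thesis using subspace_row_fiber[OF At] Atfib[OF r0] by blast
qed

text \<open>For \<open>d = n\<close> the anticode is the whole space. Below that, either all row
  fibers are large and hence equal, or one is small; the latter forces \<open>m = n\<close>, and the
  columns take over.\<close>

lemma anticode_structure:
  fixes A :: "('q::{field,finite}^'n^'m) set"
  assumes nm: "CARD('n) \<le> CARD('m)" and A: "mat_space.subspace A"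
    and card: "card A = CARD('q) ^ (CARD('m) * d)" and rank: "\<And>M. M \<in> A \<Longrightarrow> rank M \<le> d"
    and d: "0 < d"
  shows "(\<exists>V. vec.subspace V \<and> d \<le> vec.dim V \<and> (\<forall>v\<in>V. \<forall>u. outer u v \<in> A)) \<or>
    CARD('n) = CARD('m) \<and> (\<exists>H. vec.subspace H \<and> d \<le> vec.dim H \<and> (\<forall>h\<in>H. \<forall>v. outer h v \<in> A))"
proof (cases "d < CARD('n)")
  case False
  note cU = card_mat_UNIV[where 'q='q and 'm='m and 'n='n]
  have "card A \<le> card (UNIV :: ('q^'n^'m) set)" by (intro card_mono) auto
  then have "CARD('m) * d \<le> CARD('m) * CARD('n)"
    unfolding card cU by (simp only: power_card_le_iff)
  then have "d = CARD('n)" using False by simp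
  then have "A = UNIV" using card cU by (intro card_subset_eq) auto
  moreover have "vec.dim (UNIV :: ('q^'n) set) = CARD('n)" by (simp add: card_cart_basis)
  ultimately show ?thesis using \<open>d = CARD('n)\<close> by (intro disjI1 exI[of _ UNIV]) auto
next
  case True
  show ?thesis
  proof (cases "\<forall>u. u \<noteq> 0 \<longrightarrow> d \<le> vec.dim (row_fiber A u)")
    case fib: True
    obtain i0 :: 'm where True by simp
    define u0 :: "'q^'m" where "u0 = axis i0 1"
    have u0: "u0 \<noteq> 0" by (simp add: u0_def axis_eq_0_iff)
    have "outer u v \<in> A" if "v \<in> row_fiber A u0" for u v
    proof (cases "u = 0")
      case False
      then have "row_fiber A u = row_fiber A u0"
        using u0 fib rank True nm by (intro row_fibers_equal[OF A]) auto
      then show ?thesis using that by (auto simp: row_fiber_def)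
    qed (simp add: mat_space.subspace_0[OF A])
    then show ?thesis using subspace_row_fiber[OF A] fib u0 by blast
  next
    case False
    then obtain u where u: "u \<noteq> 0" "\<not> d \<le> vec.dim (row_fiber A u)" by blast
    obtain i where "u $ i \<noteq> 0" using u(1) by (auto simp: vec_eq_iff)
    have "\<not> CARD('n) < CARD('m)"
    proof
      assume "CARD('n) < CARD('m)"
      then have "d \<le> vec.dim (row_fiber A u)"
        using card rank \<open>u $ i \<noteq> 0\<close>
        by (intro dim_row_fiber_ge_tall[of A UNIV UNIV i, OF A]) (auto simp: mat_supp_def vec_supp_def)
      then show False using u(2) by simp
    qed
    then have eq: "CARD('n) = CARD('m)" using nm by simp
    then show ?thesis using full_col_fibers[OF eq A card rank d True u] by blast
  qed
qed

section \<open>Recognizing optimal anticodes and passing to smaller ones\<close>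

lemma rank_le_maxrk: "M \<in> A \<Longrightarrow> rank M \<le> maxrk A"
  unfolding maxrk_def by (intro Max_ge) auto

lemma maxrk_le_iff: "A \<noteq> {} \<Longrightarrow> maxrk A \<le> d \<longleftrightarrow> (\<forall>M\<in>A. rank M \<le> d)"
  unfolding maxrk_def by (subst Max_le_iff) auto

lemma optimal_anticode_iff_card:
  fixes A :: "('q::{field,finite}^'n^'m) set"
  shows "optimal_anticode A \<longleftrightarrow> mat_space.subspace A \<and> card A = CARD('q) ^ (CARD('m) * maxrk A)"
  unfolding optimal_anticode_def using card_mat_subspace[of A] by (auto simp: power_card_eq_iff)

text \<open>An upper bound on the ranks suffices: the dimension bound forces the maximal rank up to
  \<open>d\<close>.\<close>

lemma optimal_anticodeI:
  fixes A :: "('q::{field,finite}^'n^'m) set"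
  assumes nm: "CARD('n) \<le> CARD('m)" and A: "mat_space.subspace A"
    and card: "card A = CARD('q) ^ (CARD('m) * d)" and rank: "\<And>M. M \<in> A \<Longrightarrow> rank M \<le> d"
  shows "optimal_anticode A \<and> maxrk A = d"
proof -
  have ne: "A \<noteq> {}" using mat_space.subspace_0[OF A] by blast
  have "card A \<le> CARD('q) ^ (max (card (UNIV :: 'm set)) (card (UNIV :: 'n set)) * maxrk A)"
    by (rule card_le_of_rank_le[OF A]) (auto simp: mat_supp_def rank_le_maxrk)
  then have "CARD('m) * d \<le> CARD('m) * maxrk A"
    using nm by (simp add: card power_card_le_iff max_def split: if_splits)
  then have "d \<le> maxrk A" by simp
  moreover have "maxrk A \<le> d" using maxrk_le_iff[OF ne] rank by blast
  ultimately show ?thesis using A card by (simp add: optimal_anticode_iff_card)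
qed

definition rows_in :: "('q::field^'n) set \<Rightarrow> ('q^'n^'m) set" where
  "rows_in V = {M. \<forall>i. M $ i \<in> V}"

lemma subspace_rows_in: "vec.subspace V \<Longrightarrow> mat_space.subspace (rows_in V)"
  by (rule mat_space.subspaceI)
    (auto simp: rows_in_def mat_scale_row vec.subspace_0 vec.subspace_add vec.subspace_scale)

lemma card_rows_in:
  fixes V :: "('q::{field,finite}^'n) set"
  assumes "vec.subspace V"
  shows "card (rows_in V :: ('q^'n^'m) set) = CARD('q) ^ (CARD('m) * vec.dim V)"
proof -
  have "bij_betw vec_lambda (UNIV \<rightarrow>\<^sub>E V) (rows_in V :: ('q^'n^'m) set)"
    by (rule bij_betwI[of _ _ _ vec_nth]) (auto simp: rows_in_def)
  then have "card (rows_in V :: ('q^'n^'m) set) = card ((UNIV :: 'm set) \<rightarrow>\<^sub>E V)"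
    by (simp add: bij_betw_same_card)
  also have "\<dots> = (CARD('q) ^ vec.dim V) ^ CARD('m)"
    by (simp add: card_PiE card_vec_subspace[OF assms])
  finally show ?thesis by (simp only: power_mult[symmetric] mult.commute)
qed

lemma rank_rows_in: "M \<in> rows_in V \<Longrightarrow> rank M \<le> vec.dim V"
  by (rule rank_le_dim) (auto simp: rows_in_def vec.span_base)

text \<open>A matrix is the sum of the outer products of unit vectors with its rows.\<close>

lemma rows_in_subset:
  assumes A: "mat_space.subspace A" and "\<And>u v. v \<in> V \<Longrightarrow> outer u v \<in> A"
  shows "rows_in V \<subseteq> A"
proof
  fix M :: "'a^'b^'c" assume M: "M \<in> rows_in V"
  have "M = (\<Sum>i\<in>UNIV. outer (axis i 1) (M $ i))"
  proof (subst vec_eq_iff, subst vec_eq_iff, intro allI)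
    fix a b
    have "(\<Sum>i\<in>UNIV. axis i 1 $ a * M $ i $ b) = (\<Sum>i\<in>UNIV. if a = i then M $ i $ b else 0)"
      by (rule sum.cong) (auto simp: axis_def)
    then show "M $ a $ b = (\<Sum>i\<in>UNIV. outer (axis i 1) (M $ i)) $ a $ b"
      by (simp add: sum_component)
  qed
  also have "\<dots> \<in> A" by (rule mat_space.subspace_sum[OF A]) (use M assms(2) in \<open>auto simp: rows_in_def\<close>)
  finally show "M \<in> A" .
qed

text \<open>Shrink the common row space (or column space, if \<open>m = n\<close>) supplied by
  \<open>anticode_structure\<close> to dimension \<open>e\<close>. All matrices supported there form
  the smaller anticode.\<close>

lemma optimal_anticode_chain:
  fixes A :: "('q::{field,finite}^'n^'m) set"
  assumes nm: "CARD('n) \<le> CARD('m)" and A: "optimal_anticode A" and "maxrk A = Suc e"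
  shows "\<exists>A'. A' \<subseteq> A \<and> optimal_anticode A' \<and> maxrk A' = e"
proof -
  have sub: "mat_space.subspace A" and card: "card A = CARD('q) ^ (CARD('m) * Suc e)"
    using A assms(3) by (auto simp: optimal_anticode_iff_card)
  have rank: "rank M \<le> Suc e" if "M \<in> A" for M using rank_le_maxrk[OF that] assms(3) by simp
  consider V where "vec.subspace V" "Suc e \<le> vec.dim V" "\<And>u v. v \<in> V \<Longrightarrow> outer u v \<in> A"
    | H where "CARD('n) = CARD('m)" "vec.subspace H" "Suc e \<le> vec.dim H"
      "\<And>h v. h \<in> H \<Longrightarrow> outer h v \<in> A"
    using anticode_structure[OF nm sub card rank] by blast
  then show ?thesis
  proof cases
    case 1
    obtain V' where V': "V' \<subseteq> vec.span V" "vec.subspace V'" "vec.dim V' = e"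
      using vec.choose_subspace_of_subspace[of e V] 1(2) by auto
    have "V' \<subseteq> V" using V'(1) vec.span_minimal[OF order_refl 1(1)] by blast
    then have "rows_in V' \<subseteq> A" using 1(3) by (intro rows_in_subset[OF sub]) auto
    moreover have "optimal_anticode (rows_in V' :: ('q^'n^'m) set) \<and> maxrk (rows_in V' :: ('q^'n^'m) set) = e"
      using V' card_rows_in[OF V'(2)] rank_rows_in[of _ V']
      by (intro optimal_anticodeI[OF nm] subspace_rows_in) auto
    ultimately show ?thesis by blast
  next
    case 2
    obtain H' where H': "H' \<subseteq> vec.span H" "vec.subspace H'" "vec.dim H' = e"
      using vec.choose_subspace_of_subspace[of e H] 2(3) by auto
    have "H' \<subseteq> H" using H'(1) vec.span_minimal[OF order_refl 2(2)] by blast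
    then have "rows_in H' \<subseteq> transpose ` A" using 2(4)
      by (intro rows_in_subset[OF subspace_transpose_image[OF sub]])
        (auto simp: transpose_mem_image transpose_outer)
    then have "transpose ` rows_in H' \<subseteq> A" by (auto simp: transpose_mem_image)
    moreover have "optimal_anticode (transpose ` rows_in H' :: ('q^'n^'m) set) \<and>
        maxrk (transpose ` rows_in H' :: ('q^'n^'m) set) = e"
      using H' card_rows_in[OF H'(2), where 'm='n] rank_rows_in[of _ H'] 2(1)
      by (intro optimal_anticodeI[OF nm] subspace_transpose_image subspace_rows_in)
        (auto simp: card_transpose_image rank_transpose_eq)
    ultimately show ?thesis by blast
  qed
qed

section \<open>Generalized weights\<close>

lemma optimal_anticode_UNIV:
  assumes "CARD('n) \<le> CARD('m)"
  shows "optimal_anticode (UNIV :: ('q::{field,finite}^'n^'m) set) \<and>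
    maxrk (UNIV :: ('q^'n^'m) set) = CARD('n)"
  using card_mat_UNIV[where 'q='q and 'm='m and 'n='n]
  by (intro optimal_anticodeI[OF assms]) (auto simp: rank_le_CARD_cols intro: mat_space.subspaceI)

lemma rank_weight_le_iff:
  fixes D :: "('q::{field,finite}^'n^'m) set"
  assumes "CARD('n) \<le> CARD('m)"
  shows "rank_weight D \<le> w \<longleftrightarrow> (\<exists>A. D \<subseteq> A \<and> optimal_anticode A \<and> maxrk A \<le> w)"
proof -
  have "{maxrk A |A. D \<subseteq> A \<and> optimal_anticode A} = maxrk ` {A. D \<subseteq> A \<and> optimal_anticode A}" by blast
  moreover have "UNIV \<in> {A. D \<subseteq> A \<and> optimal_anticode A}" using optimal_anticode_UNIV[OF assms] by blast
  ultimately show ?thesis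
    unfolding rank_weight_def by (subst Min_le_iff) auto
qed

text \<open>The largest subcode of \<open>C\<close> inside an anticode \<open>A\<close> is
  \<open>C \<inter> A\<close>. So subcodes disappear from the minimum, and only intersections with
  optimal anticodes have to be counted.\<close>

lemma gen_rank_weight_le_iff:
  fixes C :: "('q::{field,finite}^'n^'m) set"
  assumes nm: "CARD('n) \<le> CARD('m)" and C: "mat_space.subspace C" "r \<le> mat_space.dim C"
  shows "gen_rank_weight r C \<le> w \<longleftrightarrow>
    (\<exists>A. optimal_anticode A \<and> maxrk A \<le> w \<and> CARD('q) ^ r \<le> card (C \<inter> A))"
proof -
  let ?D = "{D. mat_space.subspace D \<and> D \<subseteq> C \<and> r \<le> mat_space.dim D}"
  have "{rank_weight D |D. mat_space.subspace D \<and> D \<subseteq> C \<and> r \<le> mat_space.dim D} = rank_weight ` ?D"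
    by blast
  moreover have "C \<in> ?D" using C by simp
  ultimately have "gen_rank_weight r C \<le> w \<longleftrightarrow> (\<exists>D\<in>?D. rank_weight D \<le> w)"
    unfolding gen_rank_weight_def by (subst Min_le_iff) auto
  also have "\<dots> \<longleftrightarrow> (\<exists>A. optimal_anticode A \<and> maxrk A \<le> w \<and> CARD('q) ^ r \<le> card (C \<inter> A))"
  proof
    assume "\<exists>D\<in>?D. rank_weight D \<le> w"
    then obtain D A where D: "mat_space.subspace D" "D \<subseteq> C" "r \<le> mat_space.dim D"
      and A: "D \<subseteq> A" "optimal_anticode A" "maxrk A \<le> w"
      unfolding rank_weight_le_iff[OF nm] by blast
    have "CARD('q) ^ r \<le> card D"
      using D by (simp add: card_mat_subspace power_card_le_iff)
    also have "\<dots> \<le> card (C \<inter> A)" using D(2) A(1) by (intro card_mono) auto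
    finally show "\<exists>A. optimal_anticode A \<and> maxrk A \<le> w \<and> CARD('q) ^ r \<le> card (C \<inter> A)"
      using A by blast
  next
    assume "\<exists>A. optimal_anticode A \<and> maxrk A \<le> w \<and> CARD('q) ^ r \<le> card (C \<inter> A)"
    then obtain A where A: "optimal_anticode A" "maxrk A \<le> w" "CARD('q) ^ r \<le> card (C \<inter> A)" by blast
    have sub: "mat_space.subspace (C \<inter> A)"
      using C(1) A(1) by (intro mat_space.subspace_inter) (auto simp: optimal_anticode_def)
    then have "r \<le> mat_space.dim (C \<inter> A)"
      using A(3) by (simp add: card_mat_subspace power_card_le_iff)
    moreover have "rank_weight (C \<inter> A) \<le> w"
      unfolding rank_weight_le_iff[OF nm] using A by blast
    ultimately show "\<exists>D\<in>?D. rank_weight D \<le> w" using sub by blast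
  qed
  finally show ?thesis .
qed

text \<open>Take an optimal anticode \<open>A\<close> attaining the weight for \<open>r + m\<close>,
  and inside it one of maximal rank one less. Its codimension in \<open>A\<close> is
  \<open>m\<close>, so the intersection with \<open>C\<close> loses at most \<open>m\<close>
  dimensions and keeps \<open>r\<close>.\<close>

lemma gen_rank_weight_jump:
  fixes C :: "('q::{field,finite}^'n^'m) set"
  assumes nm: "CARD('n) \<le> CARD('m)" and C: "mat_space.subspace C"
    and r: "0 < r" "r + CARD('m) \<le> mat_space.dim C"
  shows "gen_rank_weight r C < gen_rank_weight (r + CARD('m)) C"
proof -
  obtain A where A: "optimal_anticode A" "maxrk A \<le> gen_rank_weight (r + CARD('m)) C"
    "CARD('q) ^ (r + CARD('m)) \<le> card (C \<inter> A)"
    using gen_rank_weight_le_iff[OF nm C r(2), of "gen_rank_weight (r + CARD('m)) C"] by blast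
  have sub: "mat_space.subspace A" and cA: "card A = CARD('q) ^ (CARD('m) * maxrk A)"
    using A(1) by (auto simp: optimal_anticode_iff_card)
  have "card (C \<inter> A) \<le> card A" by (intro card_mono) auto
  then have "r + CARD('m) \<le> CARD('m) * maxrk A"
    using A(3) cA by (metis order_trans power_card_le_iff)
  then have "maxrk A \<noteq> 0" using r(1) by (cases "maxrk A = 0") simp_all
  then obtain e where e: "maxrk A = Suc e" using not0_implies_Suc by blast
  obtain A' where A': "A' \<subseteq> A" "optimal_anticode A'" "maxrk A' = e"
    using optimal_anticode_chain[OF nm A(1) e] by blast
  have sub': "mat_space.subspace A'" and cA': "card A' = CARD('q) ^ (CARD('m) * e)"
    using A' by (auto simp: optimal_anticode_iff_card)
  have subC: "mat_space.subspace (C \<inter> A)" using C sub by (rule mat_space.subspace_inter)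
  have "card {x + y |x y. x \<in> C \<inter> A \<and> y \<in> A'} * card ((C \<inter> A) \<inter> A') = card (C \<inter> A) * card A'"
    using mat_space.subspace_diff[OF subC] mat_space.subspace_diff[OF sub']
    by (intro card_sums_mult_card_Int) simp_all
  moreover have le: "card {x + y |x y. x \<in> C \<inter> A \<and> y \<in> A'} \<le> card A"
    using A'(1) by (intro card_mono) (auto intro!: mat_space.subspace_add[OF sub])
  moreover have "(C \<inter> A) \<inter> A' = C \<inter> A'" using A'(1) by blast
  ultimately have "card (C \<inter> A) * card A' \<le> card A * card (C \<inter> A')"
    using mult_le_mono1[OF le, of "card (C \<inter> A')"] by simp
  then have "CARD('q) ^ (r + CARD('m)) * CARD('q) ^ (CARD('m) * e)
      \<le> CARD('q) ^ (CARD('m) * Suc e) * card (C \<inter> A')"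
    using A(3) unfolding cA' cA e by (meson le_trans mult_le_mono1)
  then have "CARD('q) ^ (CARD('m) * Suc e) * CARD('q) ^ r
      \<le> CARD('q) ^ (CARD('m) * Suc e) * card (C \<inter> A')"
    by (simp add: power_add mult_ac)
  then have "CARD('q) ^ r \<le> card (C \<inter> A')" by simp
  then have "gen_rank_weight r C \<le> e"
    using A' r gen_rank_weight_le_iff[OF nm C, of r e] by auto
  then show ?thesis using e A(2) by simp
qed

section \<open>Weight sequences as lists and codes with prescribed weights\<close>

lemma nth_gen_rank_weights:
  "i < mat_space.dim C \<Longrightarrow> gen_rank_weights C ! i = gen_rank_weight (Suc i) C"
  by (simp add: gen_rank_weights_def del: upt_Suc)

lemma length_gen_rank_weights: "length (gen_rank_weights C) = mat_space.dim C"
  by (simp add: gen_rank_weights_def)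

text \<open>The first and the last position of \<open>c\<close> are at least \<open>l\<close> apart,
  since all occurrences lie between them. Sortedness makes the list constant in between.\<close>

lemma sorted_count_gap:
  fixes xs :: "nat list"
  assumes "sorted xs" "l < length (filter (\<lambda>x. x = c) xs)"
  shows "\<exists>i. i + l < length xs \<and> xs ! i = c \<and> xs ! (i + l) = c"
proof -
  let ?I = "{i. i < length xs \<and> xs ! i = c}"
  have fin: "finite ?I" by simp
  have card: "l < card ?I" using assms(2) by (simp add: length_filter_conv_card)
  then have ne: "?I \<noteq> {}" by (metis card.empty not_less_zero)
  define a b where "a = Min ?I" and "b = Max ?I"
  have a: "a < length xs" "xs ! a = c" using Min_in[OF fin ne] by (auto simp: a_def)
  have b: "b < length xs" "xs ! b = c" using Max_in[OF fin ne] by (auto simp: b_def)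
  have "?I \<subseteq> {a..b}" using fin by (auto simp: a_def b_def)
  then have "card ?I \<le> card {a..b}" by (intro card_mono) auto
  then have "a + l \<le> b" using card by simp
  moreover have "xs ! a \<le> xs ! (a + l)" "xs ! (a + l) \<le> xs ! b"
    using assms(1) b(1) \<open>a + l \<le> b\<close> by (auto intro!: sorted_nth_mono)
  ultimately show ?thesis using a b by (intro exI[of _ a]) auto
qed

lemma ex_subspace_card:
  fixes S :: "('q::{field,finite}^'n^'m) set"
  assumes "mat_space.subspace S" "CARD('q) ^ a \<le> card S"
  shows "\<exists>V\<subseteq>S. mat_space.subspace V \<and> card V = CARD('q) ^ a"
proof -
  obtain B where B: "B \<subseteq> S" "mat_space.independent B" "S \<subseteq> mat_space.span B" "card B = mat_space.dim S"
    by (rule mat_space.basis_exists)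
  have "a \<le> card B"
    using assms by (simp add: B(4) card_mat_subspace power_card_le_iff)
  then obtain B' where B': "B' \<subseteq> B" "card B' = a"
    using obtain_subset_with_card_n by metis
  have "mat_space.independent B'" using B(2) B'(1) by (rule mat_space.independent_mono)
  then have "card (mat_space.span B') = CARD('q) ^ a"
    using B'(2) mat_space.dim_span_eq_card_independent[of B']
    by (simp add: card_mat_subspace[OF mat_space.subspace_span] del: mat_space.dim_span)
  moreover have "mat_space.span B' \<subseteq> S"
    using B(1) B'(1) assms(1) by (intro mat_space.span_minimal) auto
  ultimately show ?thesis by blast
qed

text \<open>\<open>E w\<close> consists of the matrices supported on the first \<open>w\<close> columns, and the nonzero
  matrices in \<open>G w\<close> have rank larger than \<open>w\<close>. Choosing the \<open>d\<close>-th summand \<open>V d\<close> of the code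
  in \<open>G (d - 1) \<inter> E d\<close> splits the code, for every \<open>w\<close>, into a part inside \<open>E w\<close> and a part
  that avoids every anticode of maximal rank at most \<open>w\<close>.\<close>

lemma ex_code_with_weights:
  fixes ds :: "nat list"
  assumes nm: "CARD('n::finite) \<le> CARD('m::finite)" and "sorted ds"
    and pos: "\<And>d. d \<in> set ds \<Longrightarrow> 0 < d" and le_n: "\<And>d. d \<in> set ds \<Longrightarrow> d \<le> CARD('n)"
    and mult: "\<And>c. length (filter (\<lambda>x. x = c) ds) \<le> CARD('m)"
  shows "\<exists>C :: ('q::{field,finite}^'n^'m) set. mat_space.subspace C \<and> gen_rank_weights C = ds"
proof -
  let ?q = "CARD('q)" and ?n = "CARD('n)" and ?m = "CARD('m)"
  obtain e :: "nat \<Rightarrow> 'n" where e: "bij_betw e {..<?n} UNIV"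
    using finite_same_card_bij[of "{..<?n}" "UNIV :: 'n set"] by auto
  define E :: "nat \<Rightarrow> ('q^'n^'m) set" where "E w = mat_supp UNIV (e ` {..<w})" for w
  have E: "mat_space.subspace (E w)" for w unfolding E_def by (rule subspace_mat_supp)
  have "card (e ` {..<w}) = w" if "w \<le> ?n" for w
    using e that by (subst card_image) (auto simp: bij_betw_def intro: inj_on_subset)
  then have cardE: "card (E w) = ?q ^ (?m * w)" and rankE: "\<And>M. M \<in> E w \<Longrightarrow> rank M \<le> w"
    if "w \<le> ?n" for w
    using that rank_le_card_row_support[of _ UNIV "e ` {..<w}"] by (auto simp: E_def card_mat_supp)
  have Emono: "E w \<subseteq> E w'" if "w \<le> w'" for w w'
    using that by (force simp: E_def mat_supp_def)
  have Eopt: "optimal_anticode (E w) \<and> maxrk (E w) = w" if "w \<le> ?n" for w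
    using optimal_anticodeI[OF nm E cardE rankE] that by blast
  have "card (UNIV :: 'n set) \<le> card (UNIV :: 'm set)" using nm .
  from max_rank_distance_codes[OF this, where 'q='q]
  obtain G :: "nat \<Rightarrow> ('q^'n^'m) set" where
    "\<forall>w. mat_space.subspace (G w) \<and> G w \<subseteq> mat_supp UNIV UNIV \<and> (\<forall>w'\<ge>w. G w' \<subseteq> G w) \<and>
      (w \<le> ?n \<longrightarrow> card (G w) = ?q ^ (?m * (?n - w)) \<and> (\<forall>M\<in>G w. rank M \<le> w \<longrightarrow> M = 0))"
    by (elim exE)
  then have G: "mat_space.subspace (G w)" and Gmono: "w \<le> w' \<Longrightarrow> G w' \<subseteq> G w"
    and cardG: "w \<le> ?n \<Longrightarrow> card (G w) = ?q ^ (?m * (?n - w))"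
    and rankG: "w \<le> ?n \<Longrightarrow> M \<in> G w \<Longrightarrow> rank M \<le> w \<Longrightarrow> M = 0" for w w' M
    by simp_all
  define a where "a c = card {i. i < length ds \<and> ds ! i = c}" for c
  have "\<exists>V\<subseteq>G (d - 1) \<inter> E d. mat_space.subspace V \<and> card V = ?q ^ a d" if d: "0 < d" "d \<le> ?n" for d
  proof (rule ex_subspace_card)
    show "mat_space.subspace (G (d - 1) \<inter> E d)" using G E by (rule mat_space.subspace_inter)
    have "card {x + y |x y. x \<in> G (d - 1) \<and> y \<in> E d} * card (G (d - 1) \<inter> E d) =
        card (G (d - 1)) * card (E d)"
      by (rule card_sums_mult_card_Int) (auto intro: mat_space.subspace_diff[OF G] mat_space.subspace_diff[OF E])
    moreover have "card {x + y |x y. x \<in> G (d - 1) \<and> y \<in> E d} \<le> ?q ^ (?m * ?n)"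
      unfolding card_mat_UNIV[where 'q='q and 'm='m and 'n='n, symmetric] by (intro card_mono) auto
    then have "card {x + y |x y. x \<in> G (d - 1) \<and> y \<in> E d} * card (G (d - 1) \<inter> E d) \<le>
        ?q ^ (?m * ?n) * card (G (d - 1) \<inter> E d)" by (rule mult_le_mono1)
    ultimately have "card (G (d - 1)) * card (E d) \<le> ?q ^ (?m * ?n) * card (G (d - 1) \<inter> E d)"
      by simp
    moreover have "card (G (d - 1)) * card (E d) = ?q ^ (?m * (?n - (d - 1)) + ?m * d)"
      using d by (simp add: cardG cardE power_add)
    \<comment> \<open>The dimensions of \<open>G (d - 1)\<close> and \<open>E d\<close> add up to
      \<open>m\<close> more than that of the whole space. The intersection thus has dimension at
      least \<open>m\<close>, enough for the multiplicity of \<open>d\<close>.\<close>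
    moreover have "?m * (?n - (d - 1)) + ?m * d = ?m * ?n + ?m"
    proof -
      have "?n - (d - 1) + d = ?n + 1" using d by simp
      then show ?thesis by (metis add_mult_distrib2 mult_1_right)
    qed
    ultimately have "?q ^ (?m * ?n) * ?q ^ ?m \<le> ?q ^ (?m * ?n) * card (G (d - 1) \<inter> E d)"
      by (simp only: power_add)
    then have "?q ^ ?m \<le> card (G (d - 1) \<inter> E d)" by simp
    moreover have "?q ^ a d \<le> ?q ^ ?m"
      using mult[of d] by (simp add: a_def length_filter_conv_card power_card_le_iff)
    ultimately show "?q ^ a d \<le> card (G (d - 1) \<inter> E d)" by (rule order_trans[rotated])
  qed
  then have "\<forall>d. \<exists>V. 0 < d \<and> d \<le> ?n \<longrightarrow>
      V \<subseteq> G (d - 1) \<inter> E d \<and> mat_space.subspace V \<and> card V = ?q ^ a d" by blast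
  then obtain V where V: "\<And>d. 0 < d \<Longrightarrow> d \<le> ?n \<Longrightarrow> V d \<subseteq> G (d - 1) \<inter> E d"
    "\<And>d. 0 < d \<Longrightarrow> d \<le> ?n \<Longrightarrow> mat_space.subspace (V d)"
    "\<And>d. 0 < d \<Longrightarrow> d \<le> ?n \<Longrightarrow> card (V d) = ?q ^ a d" by metis
  define U where "U D = mat_space.span (\<Union>d\<in>D. V d)" for D
  have U: "mat_space.subspace (U D)" for D by (simp add: U_def)
  have U_Un: "U (D \<union> D') = {x + y |x y. x \<in> U D \<and> y \<in> U D'}" for D D'
    unfolding U_def UN_Un by (rule mat_space.span_Un)
  have U_E: "U {0<..w} \<subseteq> E w" if "w \<le> ?n" for w
  proof -
    have "V d \<subseteq> E w" if "d \<in> {0<..w}" for d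
      using that \<open>w \<le> ?n\<close> V(1)[of d] Emono[of d w] by auto
    then show ?thesis unfolding U_def by (intro mat_space.span_minimal[OF _ E]) blast
  qed
  have U_G: "U {w<..?n} \<subseteq> G w" for w
  proof -
    have "V d \<subseteq> G w" if "d \<in> {w<..?n}" for d
    proof -
      have "w \<le> d - 1" "0 < d" "d \<le> ?n" using that by auto
      then show ?thesis using V(1)[of d] Gmono[of w "d - 1"] by blast
    qed
    then show ?thesis unfolding U_def by (intro mat_space.span_minimal[OF _ G]) blast
  qed
  have card_U_Un: "card (U (D \<union> D')) = card (U D) * card (U D')" if "U D \<inter> U D' = {0}" for D D'
    using card_sums_mult_card_Int[of "U D" "U D'"] that
      mat_space.subspace_diff[OF U[of D]] mat_space.subspace_diff[OF U[of D']]
    by (simp add: U_Un)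
  have GE: "G w \<inter> E w \<subseteq> {0}" if "w \<le> ?n" for w
    using rankG[OF that] rankE[OF that] by blast
  have U_single: "U {d} = V d" if "0 < d" "d \<le> ?n" for d
    using V(2)[OF that] mat_space.span_eq_iff[of "V d"] by (simp add: U_def)
  have card_U: "card (U {0<..w}) = ?q ^ card {i. i < length ds \<and> ds ! i \<le> w}" if "w \<le> ?n" for w
    using that
  proof (induction w)
    case 0
    have none: "{i. i < length ds \<and> ds ! i \<le> 0} = {}" using pos nth_mem by fastforce
    show ?case unfolding none by (simp add: U_def)
  next
    case (Suc w)
    have "U {Suc w} \<subseteq> G w" using U_single[of "Suc w"] V(1)[of "Suc w"] Suc.prems by auto
    then have "U {0<..w} \<inter> U {Suc w} = {0}"
      using U_E[of w] GE[of w] Suc.prems mat_space.subspace_0[OF U] by fastforce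
    then have "card (U ({0<..w} \<union> {Suc w})) = card (U {0<..w}) * card (V (Suc w))"
      unfolding U_single[OF zero_less_Suc Suc.prems, symmetric] by (rule card_U_Un)
    moreover have "{0<..w} \<union> {Suc w} = {0<..Suc w}" by auto
    ultimately have "card (U {0<..Suc w}) = ?q ^ (card {i. i < length ds \<and> ds ! i \<le> w} + a (Suc w))"
      using Suc V(3)[of "Suc w"] by (simp add: power_add)
    also have "card {i. i < length ds \<and> ds ! i \<le> w} + a (Suc w) =
        card ({i. i < length ds \<and> ds ! i \<le> w} \<union> {i. i < length ds \<and> ds ! i = Suc w})"
      unfolding a_def by (rule card_Un_disjoint[symmetric]) auto
    also have "{i. i < length ds \<and> ds ! i \<le> w} \<union> {i. i < length ds \<and> ds ! i = Suc w} =
        {i. i < length ds \<and> ds ! i \<le> Suc w}" by auto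
    finally show ?case .
  qed
  define C where "C = U {0<..?n}"
  have C: "mat_space.subspace C" unfolding C_def by (rule U)
  have C_split: "C = U ({0<..w} \<union> {w<..?n})" if "w \<le> ?n" for w
    unfolding C_def by (rule arg_cong[of _ _ U]) (use that in auto)
  have "{i. i < length ds \<and> ds ! i \<le> ?n} = {..<length ds}" using le_n by auto
  then have "card C = ?q ^ length ds" using card_U[of ?n] by (simp add: C_def)
  then have dimC: "mat_space.dim C = length ds"
    using card_mat_subspace[OF C] by (simp add: power_card_eq_iff)
  \<comment> \<open>Nonzero elements of \<open>U {w<..n}\<close> have rank above
    \<open>w = maxrk A\<close>, so \<open>C \<inter> A\<close> avoids this summand of
    \<open>C\<close> and is no larger than the complementary summand
    \<open>U {0<..w}\<close>.\<close>
  have meet: "card (C \<inter> A) \<le> ?q ^ card {i. i < length ds \<and> ds ! i \<le> maxrk A}"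
    if A: "optimal_anticode A" and w: "maxrk A \<le> ?n" for A
  proof -
    let ?w = "maxrk A"
    have sub: "mat_space.subspace (C \<inter> A)"
      using C A by (intro mat_space.subspace_inter) (auto simp: optimal_anticode_def)
    have "(C \<inter> A) \<inter> U {?w<..?n} = {0}"
      using U_G[of ?w] rankG[OF w] rank_le_maxrk[of _ A] mat_space.subspace_0[OF sub]
        mat_space.subspace_0[OF U] by blast
    then have "card (C \<inter> A) * card (U {?w<..?n}) = card {x + y |x y. x \<in> C \<inter> A \<and> y \<in> U {?w<..?n}}"
      using card_sums_mult_card_Int[of "C \<inter> A" "U {?w<..?n}"]
        mat_space.subspace_diff[OF sub] mat_space.subspace_diff[OF U] by simp
    also have "\<dots> \<le> card C"
    proof (rule card_mono)
      have "U {?w<..?n} \<subseteq> C" unfolding C_def U_def by (intro mat_space.span_mono UN_mono) auto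
      then show "{x + y |x y. x \<in> C \<inter> A \<and> y \<in> U {?w<..?n}} \<subseteq> C"
        using mat_space.subspace_add[OF C] by blast
    qed simp
    also have "card C = card (U {0<..?w}) * card (U {?w<..?n})"
      unfolding C_split[OF w]
    proof (rule card_U_Un)
      show "U {0<..?w} \<inter> U {?w<..?n} = {0}"
        using U_E[OF w] U_G[of ?w] GE[OF w] mat_space.subspace_0[OF U] by blast
    qed
    finally have "card (C \<inter> A) \<le> card (U {0<..?w})"
      using mat_space.subspace_0[OF U, of "{?w<..?n}"] by (auto simp: card_gt_0_iff)
    then show ?thesis using card_U[OF w] by simp
  qed
  have iff: "gen_rank_weight (Suc i) C \<le> w \<longleftrightarrow> ds ! i \<le> w" if i: "i < length ds" for i w
  proof -
    have "gen_rank_weight (Suc i) C \<le> w \<longleftrightarrow>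
        (\<exists>A. optimal_anticode A \<and> maxrk A \<le> w \<and> ?q ^ Suc i \<le> card (C \<inter> A))"
      using i dimC by (intro gen_rank_weight_le_iff[OF nm C]) simp
    also have "\<dots> \<longleftrightarrow> ds ! i \<le> w"
    proof
      assume "\<exists>A. optimal_anticode A \<and> maxrk A \<le> w \<and> ?q ^ Suc i \<le> card (C \<inter> A)"
      then obtain A where A: "optimal_anticode A" "maxrk A \<le> w" "?q ^ Suc i \<le> card (C \<inter> A)" by blast
      have "A \<noteq> {}" using A(1) mat_space.subspace_0 by (auto simp: optimal_anticode_def)
      then have "maxrk A \<le> ?n" by (simp add: maxrk_le_iff rank_le_CARD_cols)
      from order_trans[OF A(3) meet[OF A(1) this]]
      have le: "Suc i \<le> card {j. j < length ds \<and> ds ! j \<le> maxrk A}"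
        by (simp only: power_card_le_iff)
      have "ds ! i \<le> maxrk A"
      proof (rule ccontr)
        assume "\<not> ds ! i \<le> maxrk A"
        \<comment> \<open>From position \<open>i\<close> on, all entries exceed
          \<open>maxrk A\<close>, which leaves only \<open>i\<close> positions, one too few.\<close>
        then have "{j. j < length ds \<and> ds ! j \<le> maxrk A} \<subseteq> {..<i}"
          using sorted_nth_mono[OF \<open>sorted ds\<close>] by (force simp: not_le)
        then have "card {j. j < length ds \<and> ds ! j \<le> maxrk A} \<le> i"
          using card_mono[of "{..<i}"] by fastforce
        then show False using le by simp
      qed
      then show "ds ! i \<le> w" using A(2) by simp
    next
      assume le: "ds ! i \<le> w"
      have n: "ds ! i \<le> ?n" using le_n i by simp
      have "{..i} \<subseteq> {j. j < length ds \<and> ds ! j \<le> ds ! i}"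
        using i sorted_nth_mono[OF \<open>sorted ds\<close>] by auto
      then have "card {..i} \<le> card {j. j < length ds \<and> ds ! j \<le> ds ! i}"
        by (intro card_mono) auto
      \<comment> \<open>The positions 0 to \<open>i\<close> account for \<open>Suc i\<close>
        dimensions of the code inside \<open>E (ds ! i)\<close>, an optimal anticode of maximal rank
        \<open>ds ! i\<close>.\<close>
      then have "?q ^ Suc i \<le> card (U {0<..ds ! i})"
        unfolding card_U[OF n] power_card_le_iff by simp
      also have "\<dots> \<le> card (C \<inter> E (ds ! i))"
      proof (rule card_mono)
        have "U {0<..ds ! i} \<subseteq> C" unfolding C_def U_def using n by (intro mat_space.span_mono UN_mono) auto
        then show "U {0<..ds ! i} \<subseteq> C \<inter> E (ds ! i)" using U_E[OF n] by blast
      qed simp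
      finally show "\<exists>A. optimal_anticode A \<and> maxrk A \<le> w \<and> ?q ^ Suc i \<le> card (C \<inter> A)"
        using Eopt[OF n] le by auto
    qed
    finally show ?thesis .
  qed
  have "gen_rank_weights C = ds"
  proof (rule nth_equalityI)
    show "length (gen_rank_weights C) = length ds" by (simp add: length_gen_rank_weights dimC)
    fix i assume "i < length (gen_rank_weights C)"
    then have i: "i < length ds" by (simp add: length_gen_rank_weights dimC)
    then show "gen_rank_weights C ! i = ds ! i"
      using iff[OF i] by (simp add: nth_gen_rank_weights dimC eq_iff)
  qed
  then show ?thesis using C by blast
qed

theorem theorem4p13:
  fixes ds :: "nat list"
  assumes "CARD('n::finite) \<le> CARD('m::finite)"
    and "sorted ds"
    and "\<forall>d\<in>set ds. 0 < d"
  shows "(\<exists>C :: ('q::{field,finite}^'n^'m) set. mat_space.subspace C \<and> gen_rank_weights C = ds) \<longleftrightarrow>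
    length ds \<le> CARD('m) * CARD('n) \<and>
    (ds \<noteq> [] \<longrightarrow> last ds \<le> CARD('n)) \<and>
    (\<forall>es. subseq es ds \<and> (\<forall>x\<in>set es. \<forall>y\<in>set es. x = y) \<longrightarrow> length es \<le> CARD('m))"
proof (intro iffI conjI allI impI)
  assume "\<exists>C :: ('q^'n^'m) set. mat_space.subspace C \<and> gen_rank_weights C = ds"
  then obtain C :: "('q^'n^'m) set" where C: "mat_space.subspace C" and ds: "gen_rank_weights C = ds" by blast
  have len: "mat_space.dim C = length ds" using ds length_gen_rank_weights by metis
  have cardC: "card C = CARD('q) ^ length ds" using card_mat_subspace[OF C] len by simp
  have nth: "ds ! i = gen_rank_weight (Suc i) C" if "i < length ds" for i
    using nth_gen_rank_weights[of i C] that ds len by simp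
  show "length ds \<le> CARD('m) * CARD('n)"
  proof -
    have "card C \<le> card (UNIV :: ('q^'n^'m) set)" by (intro card_mono) auto
    then show ?thesis unfolding cardC card_mat_UNIV power_card_le_iff .
  qed
  show "last ds \<le> CARD('n)" if "ds \<noteq> []"
  proof -
    have "gen_rank_weight (length ds) C \<le> CARD('n)"
      unfolding gen_rank_weight_le_iff[OF assms(1) C eq_refl[OF len[symmetric]]]
      using optimal_anticode_UNIV[OF assms(1), where 'q='q] cardC by (intro exI[of _ UNIV]) simp
    then show ?thesis using that nth[of "length ds - 1"] by (simp add: last_conv_nth)
  qed
  show "length es \<le> CARD('m)" if es: "subseq es ds \<and> (\<forall>x\<in>set es. \<forall>y\<in>set es. x = y)" for es
  proof (rule ccontr)
    assume long: "\<not> length es \<le> CARD('m)"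
    then obtain c where c: "c \<in> set es" by (cases es) auto
    \<comment> \<open>A constant subsequence is bounded in length by the number of occurrences of
      its value.\<close>
    then have "filter (\<lambda>x. x = c) es = es" using es by (auto intro!: filter_True)
    then have "subseq es (filter (\<lambda>x. x = c) ds)" using es subseq_filter by metis
    then have "CARD('m) < length (filter (\<lambda>x. x = c) ds)"
      using long by (auto dest: list_emb_length)
    then obtain i where i: "i + CARD('m) < length ds" "ds ! i = c" "ds ! (i + CARD('m)) = c"
      using sorted_count_gap[OF assms(2)] by blast
    \<comment> \<open>More than \<open>m\<close> equal entries put the same value at positions
      \<open>i\<close> and \<open>i + m\<close>, against the strict jump over \<open>m\<close>
      indices. Weights are indexed from 1, list positions from 0.\<close>
    have "gen_rank_weight (Suc i) C < gen_rank_weight (Suc i + CARD('m)) C"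
      using i(1) len by (intro gen_rank_weight_jump[OF assms(1) C]) auto
    then show False using i nth[of i] nth[of "i + CARD('m)"] by simp
  qed
next
  assume *: "length ds \<le> CARD('m) * CARD('n) \<and> (ds \<noteq> [] \<longrightarrow> last ds \<le> CARD('n)) \<and>
    (\<forall>es. subseq es ds \<and> (\<forall>x\<in>set es. \<forall>y\<in>set es. x = y) \<longrightarrow> length es \<le> CARD('m))"
  show "\<exists>C :: ('q^'n^'m) set. mat_space.subspace C \<and> gen_rank_weights C = ds"
  proof (rule ex_code_with_weights[OF assms(1,2)])
    show "0 < d" if "d \<in> set ds" for d using that assms(3) by blast
    show "d \<le> CARD('n)" if d: "d \<in> set ds" for d
    proof -
      obtain i where "i < length ds" "d = ds ! i" using d by (auto simp: in_set_conv_nth)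
      then have "d \<le> last ds"
        using sorted_nth_mono[OF assms(2), of i "length ds - 1"] by (cases "ds = []") (auto simp: last_conv_nth)
      then show ?thesis using * d by fastforce
    qed
    show "length (filter (\<lambda>x. x = c) ds) \<le> CARD('m)" for c
      using * by (simp add: subseq_filter_left)
  qed
qed

end
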